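(* Consider the Gaussian sequence model $y_i=\mu_i+\sigma_n z_i$, $i=1,\ldots,n$, where $\mu\in l_p[\eta_n]$, $0<p\le\infty$, and let $\hat\mu$ be the Bayesian maximum a posteriori estimator of $\mu$ (defined in the context) based on the prior $\pi_n$ and the variance ratio $\gamma_n=\tau_n^2/\sigma_n^2$. Assume that there exist positive constants $\gamma_-$ and $\gamma_+$ such that $\gamma_-\le\gamma_n\le\gamma_+$. (1) Let $0<p\le\infty$. Assume that $\pi_n(n)\ge e^{-c_0n}$ for some $c_0>0$. Then, as $n\to\infty$, $$\sup_{\mu\in l_p[\eta_n]}E(\|\hat\mu-\mu\|_2^2)=O(n\sigma_n^2).$$ (2) Let $2\le p\le\infty$. Assume that there exists $\beta\ge0$ such that $\pi_n(0)\ge n^{-c_1n^{-\beta}}$ for some $c_1>0$. Then, as $n\to\infty$, $$\sup_{\mu\in l_p[\eta_n]}E(\|\hat\mu-\mu\|_2^2)=O(\sigma_n^2n\eta_n^2)+O(\sigma_n^2n^{-\beta}\log n).$$ (3) Let $0<p<2$. Assume that $\pi_n(\kappa)\ge(\kappa/n)^{c_2\kappa}$ for all $\kappa=1,2,\ldots,\alpha_nn$, where $n^{-1}(2\log n)^{p/2}\le\alpha_n\le\exp\{-c(\gamma_n)\}$, $c(\gamma_n)=8(\gamma_n+3/4)^2>9/2$, and for some $c_2>0$. Then, as $n\to\infty$, $$\sup_{\mu\in l_p[\eta_n]}E(\|\hat\mu-\mu\|_2^2)=O\big\{\sigma_n^2n\eta_n^p(2\log\eta_n^{-p})^{1-p/2}\big\}$$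 for all $n^{-1}(2\log n)^{p/2}\le\eta_n^p\le\alpha_n$. (4) Let $0<p<2$. Assume that there exists $\beta\ge0$ such that $\pi_n(0)\ge n^{-c_1n^{-\beta}}$ for some $c_1>0$. Then, as $n\to\infty$, $$\sup_{\mu\in l_p[\eta_n]}E(\|\hat\mu-\mu\|_2^2)=O(\sigma_n^2n^{2/p}\eta_n^2)+O(\sigma_n^2n^{-\beta}\log n)$$ for all $\eta_n^p<n^{-1}(2\log n)^{p/2}$.
   Context: Model: for each $n$ one observes $y_i=\mu_i+\sigma_nz_i$, $i=1,\ldots,n$, where $\sigma_n^2>0$ is known and may depend on $n$, the $z_i$ are independent $N(0,1)$, and $\mu=(\mu_1,\ldots,\mu_n)'$ is unknown. Balls: $l_p[\eta_n]=\{\mu\in\mathbb R^n:\|\mu\|_p\le C_n\}$ with $C_n=n^{1/p}\sigma_n\eta_n$ (for $p=\infty$: $\max_i|\mu_i|\le\sigma_n\eta_n$). Here $\eta_n>0$ is the normalized radius, which may depend on $n$. Prior: $\pi_n$ is a probability distribution on $\{0,1,\ldots,n\}$ with $\pi_n(\kappa)>0$ for all $\kappa=0,\ldots,n$ (a prior on the number of non-zero entries of $\mu$), $\tau_n^2>0$ is the prior variance of the non-zero entries, and $\gamma_n=\tau_n^2/\sigma_n^2$. Estimator: let $|y|_{(1)}\ge\cdots\ge|y|_{(n)}$ be the ordered absolute values of the observations, and let $\hat\kappa\in\{0,1,\ldots,n\}$ be a minimizer over $\kappa$ of $$\sum_{i=\kappa+1}^n|y|_{(i)}^2+P_n(\kappa),\qquad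 P_n(\kappa)=2\sigma_n^2(1+1/\gamma_n)\log\Big\{\binom n\kappa\pi_n^{-1}(\kappa)(1+\gamma_n)^{\kappa/2}\Big\}.$$ The estimator $\hat\mu=(\hat\mu_1,\ldots,\hat\mu_n)'$ is $\hat\mu_i=y_i$ if $|y_i|\ge|y|_{(\hat\kappa)}$ and $\hat\mu_i=0$ otherwise; if $\hat\kappa=0$, then $\hat\mu\equiv0$. $E$ denotes expectation under the model with mean $\mu$. The constants $\gamma_\pm,c_0,c_1,c_2,\beta$ do not depend on $n$. *)

theory Defs
  imports "HOL-Probability.Probability" "HOL-Library.Landau_Symbols"
begin

text \<open>
  A vector of \<open>\<real>\<^sup>n\<close> is an element of \<open>{1..n} \<rightarrow>\<^sub>E UNIV\<close>.
\<close>

definition observation ::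
    "nat \<Rightarrow> real \<Rightarrow> (nat \<Rightarrow> 'a \<Rightarrow> real) \<Rightarrow> (nat \<Rightarrow> real) \<Rightarrow> 'a \<Rightarrow> nat \<Rightarrow> real"
  where "observation n \<sigma> z \<mu> \<omega> = (\<lambda>i\<in>{1..n}. \<mu> i + \<sigma> * z i \<omega>)"

definition lp_norm :: "nat \<Rightarrow> ennreal \<Rightarrow> (nat \<Rightarrow> real) \<Rightarrow> real"
  where "lp_norm n p \<mu> =
    (if p = \<infinity> then MAX i\<in>{1..n}. \<bar>\<mu> i\<bar>
     else (\<Sum>i=1..n. \<bar>\<mu> i\<bar> powr enn2real p) powr (1 / enn2real p))"

definition lp_ball :: "nat \<Rightarrow> ennreal \<Rightarrow> real \<Rightarrow> real \<Rightarrow> (nat \<Rightarrow> real) set"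
  where "lp_ball n p \<sigma> \<eta> =
    {\<mu> \<in> {1..n} \<rightarrow>\<^sub>E UNIV.
       lp_norm n p \<mu> \<le> (if p = \<infinity> then \<sigma> * \<eta> else real n powr (1 / enn2real p) * \<sigma> * \<eta>)}"

text \<open>The \<open>k\<close>-th largest absolute value; only meaningful for \<open>1 \<le> k \<le> n\<close>.\<close>

definition abs_order :: "nat \<Rightarrow> (nat \<Rightarrow> real) \<Rightarrow> nat \<Rightarrow> real"
  where "abs_order n y k = rev (sort (map (\<lambda>i. \<bar>y i\<bar>) [1..<Suc n])) ! (k - 1)"

definition map_penalty :: "nat \<Rightarrow> real \<Rightarrow> real \<Rightarrow> nat pmf \<Rightarrow> nat \<Rightarrow> real"
  where "map_penalty n \<sigma> \<gamma> \<pi> \<kappa> =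
    2 * \<sigma>\<^sup>2 * (1 + 1 / \<gamma>) *
      ln (real (n choose \<kappa>) * inverse (pmf \<pi> \<kappa>) * (1 + \<gamma>) powr (real \<kappa> / 2))"

definition map_criterion ::
    "nat \<Rightarrow> real \<Rightarrow> real \<Rightarrow> nat pmf \<Rightarrow> (nat \<Rightarrow> real) \<Rightarrow> nat \<Rightarrow> real"
  where "map_criterion n \<sigma> \<gamma> \<pi> y \<kappa> =
    (\<Sum>i=Suc \<kappa>..n. (abs_order n y i)\<^sup>2) + map_penalty n \<sigma> \<gamma> \<pi> \<kappa>"

definition map_selector ::
    "nat \<Rightarrow> real \<Rightarrow> real \<Rightarrow> nat pmf \<Rightarrow> ((nat \<Rightarrow> real) \<Rightarrow> nat) \<Rightarrow> bool"
  where "map_selector n \<sigma> \<gamma> \<pi> kh \<longleftrightarrow>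
    (\<forall>y \<in> {1..n} \<rightarrow>\<^sub>E UNIV. is_arg_min (map_criterion n \<sigma> \<gamma> \<pi> y) (\<lambda>\<kappa>. \<kappa> \<le> n) (kh y))"

definition map_estimator :: "nat \<Rightarrow> ((nat \<Rightarrow> real) \<Rightarrow> nat) \<Rightarrow> (nat \<Rightarrow> real) \<Rightarrow> nat \<Rightarrow> real"
  where "map_estimator n kh y =
    (\<lambda>i\<in>{1..n}. if kh y \<noteq> 0 \<and> \<bar>y i\<bar> \<ge> abs_order n y (kh y) then y i else 0)"

text \<open>
  The minimizer is almost surely unique in the Gaussian model, and \<open>nn_integral_cong_AE\<close> needs no
  measurability; so the risk below is the usual expectation even for a selector that resolves
  ties in a non-measurable way.
\<close>

definition risk ::
    "'a measure \<Rightarrow> (nat \<Rightarrow> 'a \<Rightarrow> real) \<Rightarrow> nat \<Rightarrow> real \<Rightarrow> ((nat \<Rightarrow> real) \<Rightarrow> nat) \<Rightarrow> (nat \<Rightarrow> real) \<Rightarrow> ennreal"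
  where "risk M z n \<sigma> kh \<mu> =
    (\<integral>\<^sup>+ \<omega>. ennreal (\<Sum>i=1..n. (map_estimator n kh (observation n \<sigma> z \<mu> \<omega>) i - \<mu> i)\<^sup>2) \<partial>M)"

definition max_risk ::
    "'a measure \<Rightarrow> (nat \<Rightarrow> 'a \<Rightarrow> real) \<Rightarrow> nat \<Rightarrow> real \<Rightarrow> ((nat \<Rightarrow> real) \<Rightarrow> nat) \<Rightarrow> (nat \<Rightarrow> real) set \<Rightarrow> ennreal"
  where "max_risk M z n \<sigma> kh B = (SUP \<mu>\<in>B. risk M z n \<sigma> kh \<mu>)"

text \<open>
  Landau classes contain real sequences; membership of an extended sequence includes that it
  is eventually finite.
\<close>

definition ennreal_in_class :: "(nat \<Rightarrow> ennreal) \<Rightarrow> (nat \<Rightarrow> real) set \<Rightarrow> bool"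
  where "ennreal_in_class f G \<longleftrightarrow> (\<exists>g\<in>G. \<forall>\<^sub>F n in sequentially. f n = ennreal (g n))"

definition bigo_sum :: "(nat \<Rightarrow> real) \<Rightarrow> (nat \<Rightarrow> real) \<Rightarrow> (nat \<Rightarrow> real) set"
  where "bigo_sum f g = {\<lambda>n. u n + v n | u v. u \<in> O(f) \<and> v \<in> O(g)}"

end

theory Submission
  imports Defs "HOL-Real_Asymp.Real_Asymp"
begin

text \<open>
  With \<open>t = \<gamma> / (2 (1 + \<gamma>))\<close> the penalty is \<open>\<sigma>\<^sup>2 / t\<close> times
  \<open>ln (n choose k) + (k / 2) ln (1 + \<gamma>) + ln (1 / \<pi> k)\<close>. For a fixed set \<open>J\<close> of size \<open>k\<close> the mean of
  \<open>exp (t \<Sum>\<^sub>J z\<^sub>i\<^sup>2)\<close> is \<open>(1 + \<gamma>)\<close> to the power \<open>k / 2\<close>, so the penalty just matches a union bound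
  over all \<open>J\<close>, with no slack. The slack needed for an oracle inequality comes from three sources:
  for \<open>k \<le> \<epsilon> n\<close> from \<open>t < 1 / 2\<close>; for intermediate \<open>k\<close> from the exponential gap between the maximum
  over \<open>J\<close> and the sum over \<open>J\<close>; for \<open>k\<close> close to \<open>n\<close> from the concentration of \<open>\<Sum> z\<^sub>i\<^sup>2\<close> around
  \<open>n\<close>, since \<open>(1 + 1 / \<gamma>) ln (1 + \<gamma>) > 1\<close>. Hence, for every set \<open>S\<close>, the risk is at most a constant
  times \<open>\<sigma>\<^sup>2 |S| + P\<^sub>n |S| + \<Sum>\<^sub>i\<^sub>\<notin>\<^sub>S \<mu>\<^sub>i\<^sup>2 + \<sigma>\<^sup>2 (1 - \<pi> 0)\<close>, up to an exponentially small term. The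
  four rates follow with \<open>S\<close> full in (1), empty in (2) and (4), and of size about
  \<open>n \<eta>\<^sup>p (2 ln \<eta>\<^sup>-\<^sup>p)\<^sup>-\<^sup>p\<^sup>/\<^sup>2\<close> in (3).
\<close>

section \<open>Order statistics and binomial coefficients\<close>

text \<open>Comparing the selected set with \<open>S\<close> leaves the noise energy of the selected
  set on the right with a factor \<open>1 + 2 b\<close>: one \<open>b\<close> pays for the cross
  terms of signal and noise, the other for carrying the loss to the left. A union bound that merely
  balances the penalty cannot absorb this inflation; this is why slack is needed, and
  \<open>b\<close> may depend on the bounds for \<open>\<gamma>\<close> only. The selected size
  depends on the data, possibly in a non-measurable way. So each size \<open>k\<close> gets one
  measurable variable dominating all subsets of that size, and these variables are added over
  \<open>k\<close>. Their means come from \<open>x \<le> exp x\<close>, without tail probabilities.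
  For small \<open>k\<close> the mean excess keeps the factor \<open>pmf \<pi> k\<close> supplied by
  the penalty. Summation over \<open>k \<ge> 1\<close> gives
  \<open>1 - pmf \<pi> 0 \<le> - ln (pmf \<pi> 0)\<close>, the order of the penalty at size 0. A
  remainder of order \<open>\<sigma>^2\<close> would be too large for (2) and (4), where the rate
  may be as small as \<open>\<sigma>^2 n^(-\<beta>) ln n\<close>.\<close>

lemma sum_below_le_sum_card_eq:
  fixes f :: "'i \<Rightarrow> real"
  assumes "finite A" "T \<subseteq> A" "U \<subseteq> A" "card T = card U"
    and below: "\<And>i. i \<in> T \<Longrightarrow> f i \<le> c" and above: "\<And>i. i \<in> A - T \<Longrightarrow> c \<le> f i"
  shows "sum f T \<le> sum f U"
proof -
  have fin: "finite T" "finite U" using assms finite_subset by blast+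
  have "card (T - U) = card (U - T)"
    using fin assms(4) by (simp add: card_Diff_subset_Int Int_commute)
  have "sum f (T - U) \<le> real (card (T - U)) * c"
    using sum_bounded_above[of "T - U" f c] below by auto
  also have "\<dots> = real (card (U - T)) * c" by (simp add: \<open>card (T - U) = card (U - T)\<close>)
  also have "\<dots> \<le> sum f (U - T)"
    using sum_bounded_below[of "U - T" c f] above assms(3) by auto
  finally have "sum f (T - U) \<le> sum f (U - T)" .
  moreover have "sum f T = sum f (T \<inter> U) + sum f (T - U)" "sum f U = sum f (T \<inter> U) + sum f (U - T)"
    using sum.Int_Diff[OF fin(1), of f U] sum.Int_Diff[OF fin(2), of f T] by (simp_all add: Int_commute)
  ultimately show ?thesis by simp
qed

text \<open>Passing from sorted values to sorted indices turns sums of order statistics into sums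
  over index sets, which can be compared with an arbitrary \<open>S\<close>.\<close>

lemma abs_order_enumeration:
  obtains ps where "distinct ps" "set ps = {1..n}" "length ps = n"
    "\<And>i j. i \<le> j \<Longrightarrow> j < n \<Longrightarrow> \<bar>y (ps ! j)\<bar> \<le> \<bar>y (ps ! i)\<bar>"
    "\<And>k. k \<in> {1..n} \<Longrightarrow> abs_order n y k = \<bar>y (ps ! (k - 1))\<bar>"
proof -
  define qs where "qs = sort_key (\<lambda>i. \<bar>y i\<bar>) [1..<Suc n]"
  define ps where "ps = rev qs"
  have map_qs: "map (\<lambda>i. \<bar>y i\<bar>) qs = sort (map (\<lambda>i. \<bar>y i\<bar>) [1..<Suc n])"
    unfolding qs_def by (rule properties_for_sort[symmetric]) (simp_all del: upt_Suc)
  have len: "length ps = n" by (simp add: ps_def qs_def)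
  have sorted: "sorted (rev (map (\<lambda>i. \<bar>y i\<bar>) ps))"
    by (simp add: ps_def rev_map map_qs)
  have ord: "\<bar>y (ps ! j)\<bar> \<le> \<bar>y (ps ! i)\<bar>" if "i \<le> j" "j < n" for i j
    using sorted_rev_nth_mono[OF sorted, of i j] that len by simp
  have "abs_order n y k = \<bar>y (ps ! (k - 1))\<bar>" if "k \<in> {1..n}" for k
  proof -
    have "rev (sort (map (\<lambda>i. \<bar>y i\<bar>) [1..<Suc n])) = map (\<lambda>i. \<bar>y i\<bar>) ps"
      unfolding map_qs[symmetric] by (simp add: ps_def rev_map)
    then show ?thesis unfolding abs_order_def using that len by (subst nth_map[symmetric]) (auto simp del: upt_Suc)
  qed
  moreover have "distinct ps" "set ps = {1..n}"
    by (auto simp: ps_def qs_def simp del: upt_Suc)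
  ultimately show ?thesis using that[of ps] len ord by blast
qed

lemma sum_abs_order_tail:
  assumes "k \<le> n"
    and "distinct ps" "length ps = n"
    and "\<And>k. k \<in> {1..n} \<Longrightarrow> abs_order n y k = \<bar>y (ps ! (k - 1))\<bar>"
  shows "(\<Sum>i=Suc k..n. (abs_order n y i)\<^sup>2) = (\<Sum>i\<in>(!) ps ` {k..<n}. (y i)\<^sup>2)"
proof -
  have inj: "inj_on ((!) ps) {k..<n}"
    using assms(2,3) by (auto simp: inj_on_def nth_eq_iff_index_eq)
  have "(\<Sum>i=Suc k..n. (abs_order n y i)\<^sup>2) = (\<Sum>i=Suc k..n. (y (ps ! (i - 1)))\<^sup>2)"
    using assms(4) by (intro sum.cong) auto
  also have "\<dots> = (\<Sum>j=k..<n. (y (ps ! j))\<^sup>2)"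
    by (rule sum.reindex_bij_witness[of _ Suc "\<lambda>i. i - 1"]) auto
  finally show ?thesis by (simp add: sum.reindex[OF inj])
qed

text \<open>The smallest squares have the least sum among all index sets of the same size; the
  exchange argument compares both sets with the square at the cut.\<close>

lemma sum_abs_order_le:
  assumes "S \<subseteq> {1..n}"
  shows "(\<Sum>i=Suc (card S)..n. (abs_order n y i)\<^sup>2) \<le> (\<Sum>i\<in>{1..n} - S. (y i)\<^sup>2)"
proof -
  obtain ps where ps: "distinct ps" "set ps = {1..n}" "length ps = n"
    "\<And>i j. i \<le> j \<Longrightarrow> j < n \<Longrightarrow> \<bar>y (ps ! j)\<bar> \<le> \<bar>y (ps ! i)\<bar>"
    "\<And>k. k \<in> {1..n} \<Longrightarrow> abs_order n y k = \<bar>y (ps ! (k - 1))\<bar>"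
    by (rule abs_order_enumeration[of n y]) (rule that, assumption+)
  define k where "k = card S"
  have "k \<le> n" unfolding k_def using card_mono[OF _ assms] by simp
  define T where "T = (!) ps ` {k..<n}"
  have inj: "inj_on ((!) ps) {k..<n}"
    using ps by (auto simp: inj_on_def nth_eq_iff_index_eq)
  have "T \<subseteq> set ps" using ps(3) by (auto simp: T_def)
  then have T: "T \<subseteq> {1..n}" "card T = n - k"
    using ps(2) by (simp_all add: T_def card_image[OF inj])
  have "sum (\<lambda>i. (y i)\<^sup>2) T \<le> sum (\<lambda>i. (y i)\<^sup>2) ({1..n} - S)"
  proof (cases "k = n")
    \<comment> \<open>For \<open>k = n\<close> the list has no entry \<open>ps ! k\<close> to serve
      as the cut; \<open>T\<close> is then empty.\<close>
    case True
    then show ?thesis by (simp add: T_def sum_nonneg)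
  next
    case False
    show ?thesis
    proof (rule sum_below_le_sum_card_eq[where A = "{1..n}" and c = "(y (ps ! k))\<^sup>2"])
      show "card T = card ({1..n} - S)"
        using assms T(2) finite_subset[OF assms] by (simp add: card_Diff_subset k_def)
    next
      fix i assume "i \<in> T"
      then show "(y i)\<^sup>2 \<le> (y (ps ! k))\<^sup>2"
        using ps(4) by (auto simp: T_def abs_le_square_iff[symmetric])
    next
      fix i assume i: "i \<in> {1..n} - T"
      then obtain j where j: "j < n" "i = ps ! j" using ps(2,3) by (metis DiffD1 in_set_conv_nth)
      then have "j < k" using i by (auto simp: T_def)
      then show "(y (ps ! k))\<^sup>2 \<le> (y i)\<^sup>2"
        using ps(4)[of j k] j False \<open>k \<le> n\<close> by (auto simp: abs_le_square_iff[symmetric])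
    qed (use T in auto)
  qed
  then show ?thesis
    using sum_abs_order_tail[OF \<open>k \<le> n\<close> ps(1,3,5)] by (simp add: k_def[symmetric] T_def)
qed

text \<open>With ties the threshold rule could keep more than \<open>k\<close> indices. Injectivity
  makes the estimator and the criterion refer to the same set.\<close>

lemma abs_order_selection:
  assumes "1 \<le> k" "k \<le> n" and inj: "inj_on (\<lambda>i. \<bar>y i\<bar>) {1..n}"
  defines "T \<equiv> {i \<in> {1..n}. abs_order n y k \<le> \<bar>y i\<bar>}"
  shows "card T = k"
    and "(\<Sum>i=Suc k..n. (abs_order n y i)\<^sup>2) = (\<Sum>i\<in>{1..n} - T. (y i)\<^sup>2)"
proof -
  obtain ps where ps: "distinct ps" "set ps = {1..n}" "length ps = n"
    "\<And>i j. i \<le> j \<Longrightarrow> j < n \<Longrightarrow> \<bar>y (ps ! j)\<bar> \<le> \<bar>y (ps ! i)\<bar>"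
    "\<And>k. k \<in> {1..n} \<Longrightarrow> abs_order n y k = \<bar>y (ps ! (k - 1))\<bar>"
    by (rule abs_order_enumeration[of n y]) (rule that, assumption+)
  have mem: "ps ! j \<in> T \<longleftrightarrow> j < k" if j: "j < n" for j
  proof
    assume "ps ! j \<in> T"
    then have le: "\<bar>y (ps ! (k - 1))\<bar> \<le> \<bar>y (ps ! j)\<bar>" using ps(5)[of k] assms(1,2) by (simp add: T_def)
    show "j < k"
    proof (rule ccontr)
      assume "\<not> j < k"
      then have "\<bar>y (ps ! j)\<bar> = \<bar>y (ps ! (k - 1))\<bar>" using ps(4)[of "k - 1" j] le j by simp
      then have "ps ! j = ps ! (k - 1)"
        using inj_onD[OF inj] nth_mem[of j ps] nth_mem[of "k - 1" ps] ps(2,3) j assms(1,2) by simp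
      then show False
        using ps(1,3) j assms(1,2) \<open>\<not> j < k\<close> by (auto simp: nth_eq_iff_index_eq)
    qed
  next
    assume "j < k"
    then have "abs_order n y k \<le> \<bar>y (ps ! j)\<bar>" using ps(4)[of j "k - 1"] ps(5)[of k] assms(1,2) by simp
    then show "ps ! j \<in> T" using ps(2,3) j nth_mem[of j ps] by (auto simp: T_def)
  qed
  have sub: "T \<subseteq> {1..n}" by (auto simp: T_def)
  have all: "{1..n} = (!) ps ` {..<n}"
    using ps(2,3) by (auto simp: set_conv_nth)
  have split: "T = (!) ps ` {..<k}"
  proof
    show "T \<subseteq> (!) ps ` {..<k}" using sub mem unfolding all by auto
    show "(!) ps ` {..<k} \<subseteq> T" using mem assms(2) by auto
  qed
  have split': "{1..n} - T = (!) ps ` {k..<n}"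
  proof
    show "{1..n} - T \<subseteq> (!) ps ` {k..<n}" using mem unfolding all by (auto simp: image_iff)
    show "(!) ps ` {k..<n} \<subseteq> {1..n} - T" using mem unfolding all by auto
  qed
  have "inj_on ((!) ps) {..<k}"
    using ps assms(2) by (auto simp: inj_on_def nth_eq_iff_index_eq)
  then show "card T = k" by (simp add: split card_image)
  show "(\<Sum>i=Suc k..n. (abs_order n y i)\<^sup>2) = (\<Sum>i\<in>{1..n} - T. (y i)\<^sup>2)"
    unfolding split' by (rule sum_abs_order_tail[OF assms(2) ps(1,3,5)])
qed

text \<open>The \<open>k\<close>-th of the \<open>n + 1\<close> terms in the expansion of \<open>(k + (n - k))\<^sup>n\<close> is the largest.\<close>

lemma binomial_mode:
  assumes "k \<le> n"
  shows "n ^ n \<le> (n + 1) * ((n choose k) * k ^ k * (n - k) ^ (n - k))"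
proof -
  define a where "a j = (n choose j) * k ^ j * (n - k) ^ (n - j)" for j
  \<comment> \<open>The ratio of consecutive terms is \<open>(n - j) k / ((j + 1) (n - k))\<close>,
    at least 1 for \<open>j < k\<close> and at most 1 from \<open>j = k\<close> on. The product form
    survives \<open>n - k = 0\<close>.\<close>
  have step: "(Suc j) * (n - k) * a (Suc j) = (n - j) * k * a j" if "j < n" for j
  proof -
    have e: "Suc j * (n choose Suc j) = (n - j) * (n choose j)"
      by (simp only: binomial_absorption binomial_absorb_comp)
    have p: "n - j = Suc (n - Suc j)" using that by simp
    have "(Suc j) * (n - k) * a (Suc j)
        = (Suc j * (n choose Suc j)) * k * k ^ j * ((n - k) * (n - k) ^ (n - Suc j))"
      by (simp only: a_def power_Suc mult_ac)
    also have "(n - k) * (n - k) ^ (n - Suc j) = (n - k) ^ (n - j)"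
      by (simp add: p)
    finally show ?thesis by (simp only: e a_def mult_ac)
  qed
  have up: "a j \<le> a (Suc j)" if "j < k" for j
  proof (cases "k = n")
    case True
    then show ?thesis using that by (simp add: a_def power_0_left)
  next
    case False
    have "Suc j * (n - k) \<le> (n - j) * k"
      using mult_le_mono[of "Suc j" k "n - k" "n - j"] that by (simp add: mult.commute)
    then have "Suc j * (n - k) * a j \<le> (n - j) * k * a j" by (rule mult_right_mono) simp
    also have "\<dots> = Suc j * (n - k) * a (Suc j)" using step[of j] that assms by simp
    finally show ?thesis using False assms by simp
  qed
  have down: "a (Suc j) \<le> a j" if "k \<le> j" "j < n" for j
  proof -
    have "(n - j) * k \<le> Suc j * (n - k)"
      using mult_le_mono[of "n - j" "n - k" k "Suc j"] that by (simp add: mult.commute)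
    then have "Suc j * (n - k) * a (Suc j) \<le> Suc j * (n - k) * a j"
      using step[of j] that by simp
    then show ?thesis using that by simp
  qed
  have "a j \<le> a k" if "j \<le> n" for j
  proof (cases "j \<le> k")
    case True
    then show ?thesis
    proof (induction rule: inc_induct)
      case (step m)
      then show ?case using up[of m] by simp
    qed simp
  next
    case False
    then have "k \<le> j" by simp
    then show ?thesis using that
    proof (induction rule: dec_induct)
      case (step m)
      then show ?case using down[of m] by simp
    qed simp
  qed
  then have "(\<Sum>j\<le>n. a j) \<le> (n + 1) * a k"
    using sum_bounded_above[of "{..n}" a "a k"] by simp
  moreover have "(\<Sum>j\<le>n. a j) = n ^ n"
    using binomial_ring[of k "n - k" n] assms by (simp add: a_def)
  ultimately show ?thesis by (simp add: a_def)
qed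

text \<open>Logarithm of \<open>(e n / k)^k\<close>: one term of the expansion of
  \<open>(k + (n - k))^n\<close> is at most the whole, and
  \<open>(n - k) ln (n / (n - k)) \<le> k\<close>.\<close>

lemma ln_binomial_le:
  assumes "1 \<le> k" "k \<le> n"
  shows "ln (real (n choose k)) \<le> real k * (1 + ln (real n / real k))"
proof -
  define a where "a j = (n choose j) * k ^ j * (n - k) ^ (n - j)" for j
  have "a k \<le> (\<Sum>j\<le>n. a j)" using assms by (intro member_le_sum) auto
  also have "\<dots> = n ^ n"
    using binomial_ring[of k "n - k" n] assms by (simp add: a_def)
  finally have "real (n choose k) * real k ^ k * real (n - k) ^ (n - k) \<le> real n ^ n"
    unfolding a_def by (metis of_nat_le_iff of_nat_mult of_nat_power)
  then have le: "real (n choose k) * (real k ^ k * real (n - k) ^ (n - k)) \<le> real n ^ n"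
    by (simp add: mult.assoc)
  show ?thesis
  proof (cases "k = n")
    case True
    then show ?thesis using assms by simp
  next
    case False
    then have nk: "0 < real (n - k)" using assms by simp
    have C: "0 < real (n choose k)" using assms by simp
    have "ln (real (n choose k) * (real k ^ k * real (n - k) ^ (n - k))) \<le> ln (real n ^ n)"
      using le C nk assms by (intro ln_mono) auto
    then have l: "ln (real (n choose k)) + real k * ln (real k) + real (n - k) * ln (real (n - k))
        \<le> real n * ln (real n)"
      using C nk assms by (simp add: ln_mult ln_realpow)
    have "ln (real n / real (n - k)) \<le> real n / real (n - k) - 1"
      using nk assms by (intro ln_le_minus_one) auto
    also have "\<dots> = real k / real (n - k)" using nk assms by (simp add: field_simps of_nat_diff)
    finally have "real (n - k) * ln (real n / real (n - k)) \<le> real k"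
      using nk by (simp add: field_simps)
    then have "real (n - k) * (ln (real n) - ln (real (n - k))) \<le> real k"
      using nk assms by (simp add: ln_div)
    then show ?thesis using l assms
      by (simp add: ln_div algebra_simps of_nat_diff)
  qed
qed

text \<open>It yields \<open>(1 + 1 / \<gamma>) ln (1 + \<gamma>) \<ge> 1 + \<gamma> / (2 +
  \<gamma>)\<close>, the explicit margin for selections of nearly full size.\<close>

lemma ln_one_plus_ge:
  fixes x :: real
  assumes "0 \<le> x"
  shows "2 * x / (2 + x) \<le> ln (1 + x)"
proof -
  have "ln (1 + 0) - 2 * 0 / (2 + 0) \<le> ln (1 + x) - 2 * x / (2 + x)"
  proof (rule DERIV_nonneg_imp_nondecreasing[OF assms])
    fix t :: real assume t: "0 \<le> t" "t \<le> x"
    have "((\<lambda>x. ln (1 + x) - 2 * x / (2 + x)) has_real_derivative t\<^sup>2 / ((1 + t) * (2 + t)\<^sup>2)) (at t)"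
    proof -
      have "((\<lambda>x. ln (1 + x) - 2 * x / (2 + x)) has_real_derivative
          1 / (1 + t) - (2 * (2 + t) - 2 * t * 1) / ((2 + t) * (2 + t))) (at t)"
        using t by (auto intro!: derivative_eq_intros)
      moreover have "1 / (1 + t) - (2 * (2 + t) - 2 * t * 1) / ((2 + t) * (2 + t))
          = t\<^sup>2 / ((1 + t) * (2 + t)\<^sup>2)"
        using t by (simp add: divide_simps power2_eq_square) (simp add: algebra_simps)
      ultimately show ?thesis by simp
    qed
    then show "\<exists>y. ((\<lambda>x. ln (1 + x) - 2 * x / (2 + x)) has_real_derivative y) (at t) \<and> 0 \<le> y"
      using t by (intro exI[of _ "t\<^sup>2 / ((1 + t) * (2 + t)\<^sup>2)"]) auto
  qed
  then show ?thesis by simp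
qed

section \<open>Exponential moments of subset sums\<close>

text \<open>Tilting by \<open>exp (s x^2)\<close> turns the standard normal density into
  \<open>\<tau>\<close> times the centred normal density of variance
  \<open>\<tau>^2 = 1 / (1 - 2 s)\<close>.\<close>

lemma nn_integral_std_normal_exp_square:
  assumes "s < 1 / 2"
  shows "(\<integral>\<^sup>+x. ennreal (std_normal_density x * exp (s * x\<^sup>2)) \<partial>lborel) = ennreal (1 / sqrt (1 - 2 * s))"
proof -
  define \<tau> where "\<tau> = 1 / sqrt (1 - 2 * s)"
  have \<tau>: "0 < \<tau>" "\<tau>\<^sup>2 = 1 / (1 - 2 * s)"
    using assms by (auto simp: \<tau>_def power_divide)
  have "std_normal_density x * exp (s * x\<^sup>2) = \<tau> * normal_density 0 \<tau> x" for x
  proof -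
    have "sqrt (2 * pi * \<tau>\<^sup>2) = sqrt (2 * pi) * \<tau>"
      using \<tau>(1) by (simp add: real_sqrt_mult)
    moreover have "- x\<^sup>2 / 2 + s * x\<^sup>2 = - x\<^sup>2 / (2 * \<tau>\<^sup>2)"
      using assms unfolding \<tau>(2) by (simp add: field_simps)
    ultimately show ?thesis
      using \<tau>(1) unfolding std_normal_density_def normal_density_def
      by (simp add: exp_add[symmetric])
  qed
  then have "(\<integral>\<^sup>+x. ennreal (std_normal_density x * exp (s * x\<^sup>2)) \<partial>lborel)
      = (\<integral>\<^sup>+x. ennreal \<tau> * ennreal (normal_density 0 \<tau> x) \<partial>lborel)"
    using \<tau>(1) by (intro nn_integral_cong) (simp add: ennreal_mult' del: ennreal_mult)
  also have "\<dots> = ennreal \<tau> * (\<integral>\<^sup>+x. ennreal (normal_density 0 \<tau> x) \<partial>lborel)"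
    by (intro nn_integral_cmult) simp
  also have "(\<integral>\<^sup>+x. ennreal (normal_density 0 \<tau> x) \<partial>lborel) = 1"
    using \<tau>(1) by (simp add: nn_integral_eq_integral)
  finally show ?thesis by (simp add: \<tau>_def)
qed

locale gaussian_noise = prob_space M for M :: "'a measure" +
  fixes n :: nat and z :: "nat \<Rightarrow> 'a \<Rightarrow> real"
  assumes indep: "indep_vars (\<lambda>_. borel) z {1..n}"
    and normal: "\<And>i. i \<in> {1..n} \<Longrightarrow> distributed M lborel (z i) (\<lambda>x. ennreal (std_normal_density x))"
begin

lemma measurable_z: "i \<in> {1..n} \<Longrightarrow> z i \<in> borel_measurable M"
  using distributed_measurable[OF normal] by simp

lemma measurable_sum_z:
  fixes \<phi> :: "real \<Rightarrow> real"
  assumes "\<phi> \<in> borel_measurable borel"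
  shows "(\<lambda>\<omega>. \<Sum>i=1..n. \<phi> (z i \<omega>)) \<in> borel_measurable M"
  by (intro borel_measurable_sum measurable_compose[OF measurable_z assms])

text \<open>Equal absolute values mean equality up to sign, which pins \<open>z i - z j\<close> or
  \<open>z i + z j\<close> to a single point; both are Gaussian and have no atoms.\<close>

lemma AE_no_ties:
  assumes "\<sigma> \<noteq> 0"
  shows "AE \<omega> in M. inj_on (\<lambda>i. \<bar>\<mu> i + \<sigma> * z i \<omega>\<bar>) {1..n}"
proof -
  have "AE \<omega> in M. \<bar>\<mu> i + \<sigma> * z i \<omega>\<bar> \<noteq> \<bar>\<mu> j + \<sigma> * z j \<omega>\<bar>"
    if ij: "i \<in> {1..n}" "j \<in> {1..n}" "i \<noteq> j" for i j
  proof -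
    have "indep_var borel (z i) borel (\<lambda>\<omega>. \<Sum>l\<in>{j}. z l \<omega>)"
      using ij by (intro indep_vars_sum indep_vars_subset[OF indep]) auto
    then have ind: "indep_var borel (z i) borel (z j)" by simp
    have ne: "AE \<omega> in M. X \<omega> \<noteq> c"
      if "distributed M lborel X (\<lambda>x. ennreal (normal_density a b x))" for X c a b
      using distributed_AE2[OF that, of "\<lambda>x. x \<noteq> c"] AE_lborel_singleton[of c] by auto
    have "AE \<omega> in M. z i \<omega> - z j \<omega> \<noteq> (\<mu> j - \<mu> i) / \<sigma>"
      by (rule ne[OF diff_indep_normal[OF ind _ _ normal[OF ij(1)] normal[OF ij(2)]]]) auto
    moreover have "AE \<omega> in M. z i \<omega> + z j \<omega> \<noteq> - (\<mu> j + \<mu> i) / \<sigma>"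
      by (rule ne[OF add_indep_normal[OF ind _ _ normal[OF ij(1)] normal[OF ij(2)]]]) auto
    ultimately show ?thesis
    proof eventually_elim
      case (elim \<omega>)
      then show ?case
        using assms by (auto simp: abs_eq_iff field_simps)
    qed
  qed
  then have "AE \<omega> in M. \<forall>i\<in>{1..n}. \<forall>j\<in>{1..n}. i \<noteq> j \<longrightarrow>
      \<bar>\<mu> i + \<sigma> * z i \<omega>\<bar> \<noteq> \<bar>\<mu> j + \<sigma> * z j \<omega>\<bar>"
    by (simp add: AE_finite_all)
  then show ?thesis by eventually_elim (auto simp: inj_on_def)
qed

lemma nn_integral_exp_sum_le:
  assumes [measurable]: "\<phi> \<in> borel_measurable borel" and "0 \<le> C"
    and C: "(\<integral>\<^sup>+x. ennreal (std_normal_density x * exp (\<phi> x)) \<partial>lborel) \<le> ennreal C"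
  shows "(\<integral>\<^sup>+\<omega>. ennreal (exp (\<Sum>i=1..n. \<phi> (z i \<omega>))) \<partial>M) \<le> ennreal (C ^ n)"
proof -
  have "(\<integral>\<^sup>+\<omega>. ennreal (exp (\<Sum>i=1..n. \<phi> (z i \<omega>))) \<partial>M)
      = (\<integral>\<^sup>+\<omega>. (\<Prod>i\<in>{1..n}. ennreal (exp (\<phi> (z i \<omega>)))) \<partial>M)"
    by (simp add: exp_sum prod_ennreal)
  also have "\<dots> = (\<Prod>i\<in>{1..n}. \<integral>\<^sup>+\<omega>. ennreal (exp (\<phi> (z i \<omega>))) \<partial>M)"
    by (rule indep_vars_nn_integral[OF _ indep_vars_compose2[OF indep]]) auto
  also have "\<dots> \<le> (\<Prod>i\<in>{1..n}. ennreal C)"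
  proof (rule prod_mono_ennreal)
    fix i assume i: "i \<in> {1..n}"
    have "(\<integral>\<^sup>+\<omega>. ennreal (exp (\<phi> (z i \<omega>))) \<partial>M)
        = (\<integral>\<^sup>+x. ennreal (std_normal_density x) * ennreal (exp (\<phi> x)) \<partial>lborel)"
      by (rule distributed_nn_integral[OF normal[OF i], symmetric]) measurable
    also have "\<dots> \<le> ennreal C" using C by (simp add: ennreal_mult')
    finally show "(\<integral>\<^sup>+\<omega>. ennreal (exp (\<phi> (z i \<omega>))) \<partial>M) \<le> ennreal C" .
  qed
  also have "\<dots> = ennreal (C ^ n)" using \<open>0 \<le> C\<close> by (simp add: ennreal_power)
  finally show ?thesis .
qed

text \<open>
  The sum over any \<open>k\<close> coordinates is at most \<open>k q + \<Sum>\<^sub>i (z\<^sub>i\<^sup>2 - q)\<^sub>+\<close>, whatever the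
  level \<open>q\<close>. Unlike a union bound over subsets this keeps track of the gap between the maximum
  and the sum over subsets; \<open>m\<close> measures that gap.
\<close>

lemma exp_subset_sum_bound:
  assumes "0 \<le> s" "s \<le> s'" "s' < 1 / 2" "0 \<le> m" "m \<le> 1" "m \<le> exp (- s' * q)"
  obtains B :: "'a \<Rightarrow> real" where "B \<in> borel_measurable M" "\<And>\<omega>. 0 \<le> B \<omega>"
    "\<And>\<omega> J. J \<subseteq> {1..n} \<Longrightarrow> card J = k \<Longrightarrow> exp (s * (\<Sum>i\<in>J. (z i \<omega>)\<^sup>2)) \<le> B \<omega>"
    "(\<integral>\<^sup>+\<omega>. ennreal (B \<omega>) \<partial>M)
      \<le> ennreal (exp (s * real k * q) * (1 - m + exp (- s' * q) / sqrt (1 - 2 * s')) ^ n)"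
proof -
  define \<phi> where "\<phi> x = s * max 0 (x\<^sup>2 - q)" for x :: real
  define C where "C = 1 - m + exp (- s' * q) / sqrt (1 - 2 * s')"
  have [measurable]: "\<phi> \<in> borel_measurable borel" unfolding \<phi>_def by measurable
  have "0 \<le> C" using assms by (simp add: C_def)
  \<comment> \<open>Above the level \<open>q\<close> the bound
    \<open>1 + exp (- s' q) exp (s' x^2)\<close> wastes the summand 1; below it, it wastes the
    exponential, which is at least \<open>exp (- s' q)\<close>. Since \<open>m\<close> exceeds
    neither, it can be subtracted everywhere.\<close>
  have pw: "exp (\<phi> x) \<le> 1 - m + exp (- s' * q) * exp (s' * x\<^sup>2)" for x
  proof (cases "q \<le> x\<^sup>2")
    case True
    then have "exp (\<phi> x) \<le> exp (s' * (x\<^sup>2 - q))"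
      using assms by (simp add: \<phi>_def mult_right_mono)
    also have "\<dots> = exp (- s' * q) * exp (s' * x\<^sup>2)"
      by (simp add: exp_add[symmetric] algebra_simps)
    finally show ?thesis using assms(5) by linarith
  next
    case False
    have "m \<le> exp (- s' * q) * exp (s' * x\<^sup>2)"
    proof -
      have "exp (- s' * q) * 1 \<le> exp (- s' * q) * exp (s' * x\<^sup>2)"
        using assms by (intro mult_left_mono) auto
      then show ?thesis using assms(6) by linarith
    qed
    then show ?thesis using False by (simp add: \<phi>_def)
  qed
  have "(\<integral>\<^sup>+x. ennreal (std_normal_density x * exp (\<phi> x)) \<partial>lborel)
      \<le> (\<integral>\<^sup>+x. ennreal (1 - m) * ennreal (std_normal_density x) +
          ennreal (exp (- s' * q)) * ennreal (std_normal_density x * exp (s' * x\<^sup>2)) \<partial>lborel)"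
  proof (rule nn_integral_mono)
    fix x
    have "std_normal_density x * exp (\<phi> x)
        \<le> std_normal_density x * (1 - m + exp (- s' * q) * exp (s' * x\<^sup>2))"
      using pw by (intro mult_left_mono) auto
    also have "\<dots> = (1 - m) * std_normal_density x + exp (- s' * q) * (std_normal_density x * exp (s' * x\<^sup>2))"
      by (simp add: algebra_simps)
    finally show "ennreal (std_normal_density x * exp (\<phi> x)) \<le> ennreal (1 - m) * ennreal (std_normal_density x) +
          ennreal (exp (- s' * q)) * ennreal (std_normal_density x * exp (s' * x\<^sup>2))"
      using assms by (simp add: ennreal_mult'[symmetric] ennreal_plus[symmetric] ennreal_leI del: ennreal_plus)
  qed
  also have "\<dots> = ennreal (1 - m) * (\<integral>\<^sup>+x. ennreal (std_normal_density x) \<partial>lborel) +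
      ennreal (exp (- s' * q)) * (\<integral>\<^sup>+x. ennreal (std_normal_density x * exp (s' * x\<^sup>2)) \<partial>lborel)"
    by (simp add: nn_integral_add nn_integral_cmult)
  also have "(\<integral>\<^sup>+x. ennreal (std_normal_density x) \<partial>lborel) = 1"
    by (simp add: nn_integral_eq_integral)
  also have "(\<integral>\<^sup>+x. ennreal (std_normal_density x * exp (s' * x\<^sup>2)) \<partial>lborel) = ennreal (1 / sqrt (1 - 2 * s'))"
    by (rule nn_integral_std_normal_exp_square[OF assms(3)])
  also have "ennreal (1 - m) * 1 + ennreal (exp (- s' * q)) * ennreal (1 / sqrt (1 - 2 * s')) = ennreal C"
    using assms by (simp add: C_def ennreal_mult'[symmetric] ennreal_plus[symmetric] del: ennreal_plus)
  finally have "(\<integral>\<^sup>+x. ennreal (std_normal_density x * exp (\<phi> x)) \<partial>lborel) \<le> ennreal C" .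
  from nn_integral_exp_sum_le[OF _ \<open>0 \<le> C\<close> this]
  have int: "(\<integral>\<^sup>+\<omega>. ennreal (exp (\<Sum>i=1..n. \<phi> (z i \<omega>))) \<partial>M) \<le> ennreal (C ^ n)" by simp
  have [measurable]: "(\<lambda>\<omega>. \<Sum>i=1..n. \<phi> (z i \<omega>)) \<in> borel_measurable M"
    by (rule measurable_sum_z) simp
  define B where "B \<omega> = exp (s * real k * q) * exp (\<Sum>i=1..n. \<phi> (z i \<omega>))" for \<omega>
  show thesis
  proof
    show "B \<in> borel_measurable M" unfolding B_def by measurable
    show "0 \<le> B \<omega>" for \<omega> by (simp add: B_def)
    show "exp (s * (\<Sum>i\<in>J. (z i \<omega>)\<^sup>2)) \<le> B \<omega>"
      if J: "J \<subseteq> {1..n}" "card J = k" for \<omega> J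
    proof -
      have "s * (\<Sum>i\<in>J. (z i \<omega>)\<^sup>2) = (\<Sum>i\<in>J. s * q + s * ((z i \<omega>)\<^sup>2 - q))"
        by (simp add: sum_distrib_left algebra_simps)
      also have "\<dots> \<le> (\<Sum>i\<in>J. s * q + \<phi> (z i \<omega>))"
        using assms(1) by (intro sum_mono add_left_mono) (auto simp: \<phi>_def intro!: mult_left_mono)
      also have "\<dots> = s * real (card J) * q + (\<Sum>i\<in>J. \<phi> (z i \<omega>))"
        by (simp add: sum.distrib)
      also have "\<dots> \<le> s * real (card J) * q + (\<Sum>i=1..n. \<phi> (z i \<omega>))"
        using J(1) assms(1) by (intro add_left_mono sum_mono2) (auto simp: \<phi>_def)
      finally show ?thesis using J(2) by (simp add: B_def exp_add[symmetric])
    qed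
    have "(\<integral>\<^sup>+\<omega>. ennreal (B \<omega>) \<partial>M)
        = (\<integral>\<^sup>+\<omega>. ennreal (exp (s * real k * q)) * ennreal (exp (\<Sum>i=1..n. \<phi> (z i \<omega>))) \<partial>M)"
      by (simp add: B_def ennreal_mult')
    also have "\<dots> = ennreal (exp (s * real k * q)) * (\<integral>\<^sup>+\<omega>. ennreal (exp (\<Sum>i=1..n. \<phi> (z i \<omega>))) \<partial>M)"
      by (rule nn_integral_cmult) measurable
    also have "\<dots> \<le> ennreal (exp (s * real k * q)) * ennreal (C ^ n)"
      by (rule mult_left_mono[OF int]) simp
    also have "\<dots> = ennreal (exp (s * real k * q) * C ^ n)"
      using \<open>0 \<le> C\<close> by (simp add: ennreal_mult')
    finally show "(\<integral>\<^sup>+\<omega>. ennreal (B \<omega>) \<partial>M)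
      \<le> ennreal (exp (s * real k * q) * (1 - m + exp (- s' * q) / sqrt (1 - 2 * s')) ^ n)"
      by (simp add: C_def)
  qed
qed

text \<open>Concentration in the form of a dominating variable: \<open>x \<le> exp (s x) / s\<close>
  controls the positive part of the deviation directly in mean.\<close>

lemma square_sum_concentration:
  assumes "0 < d" "d \<le> 1"
  obtains B :: "'a \<Rightarrow> real" where "B \<in> borel_measurable M" "\<And>\<omega>. 0 \<le> B \<omega>"
    "\<And>\<omega>. (\<Sum>i=1..n. (z i \<omega>)\<^sup>2) - (1 + d) * real n \<le> B \<omega>"
    "(\<integral>\<^sup>+\<omega>. ennreal (B \<omega>) \<partial>M) \<le> ennreal (8 / d * exp (- (d\<^sup>2 / 16) * real n))"
proof -
  \<comment> \<open>The value \<open>d / 8\<close> minimizes the exponent \<open>4 s^2 - s d\<close>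
    per coordinate; the minimum is \<open>- d^2 / 16\<close>.\<close>
  define s where "s = d / 8"
  define C where "C = 1 / sqrt (1 - 2 * s)"
  define S where "S \<omega> = (\<Sum>i=1..n. s * (z i \<omega>)\<^sup>2)" for \<omega>
  define B where "B \<omega> = exp (- s * (1 + d) * real n) / s * exp (S \<omega>)" for \<omega>
  have s: "0 < s" "s \<le> 1 / 8" using assms by (auto simp: s_def)
  have C: "0 \<le> C" using s by (simp add: C_def)
  have [measurable]: "S \<in> borel_measurable M"
    unfolding S_def by (rule measurable_sum_z) measurable
  have "(\<integral>\<^sup>+\<omega>. ennreal (exp (S \<omega>)) \<partial>M) \<le> ennreal (C ^ n)"
    unfolding S_def using nn_integral_std_normal_exp_square[of s] s C
    by (intro nn_integral_exp_sum_le) (auto simp: C_def)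
  then have "(\<integral>\<^sup>+\<omega>. ennreal (B \<omega>) \<partial>M) \<le> ennreal (exp (- s * (1 + d) * real n) / s) * ennreal (C ^ n)"
    using s by (simp add: B_def ennreal_mult' nn_integral_cmult mult_left_mono del: times_divide_eq_left)
  also have "\<dots> = ennreal (exp (- s * (1 + d) * real n) / s * C ^ n)"
    using C s by (intro ennreal_mult[symmetric]) auto
  also have "\<dots> \<le> ennreal (8 / d * exp (- (d\<^sup>2 / 16) * real n))"
  proof (rule ennreal_leI)
    have "- (2 * s) - 2 * (2 * s)\<^sup>2 \<le> ln (1 - 2 * s)"
      using s by (intro ln_one_minus_pos_lower_bound) auto
    then have "ln C \<le> s + 4 * s\<^sup>2"
      using s by (simp add: C_def ln_div ln_sqrt power2_eq_square)
    then have "C \<le> exp (s + 4 * s\<^sup>2)"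
    proof -
      have "0 < C" using s by (simp add: C_def)
      then show ?thesis using \<open>ln C \<le> s + 4 * s\<^sup>2\<close> exp_le_cancel_iff[of "ln C" "s + 4 * s\<^sup>2"] by simp
    qed
    then have "C ^ n \<le> exp (s + 4 * s\<^sup>2) ^ n" using C by (rule power_mono)
    also have "\<dots> = exp (real n * (s + 4 * s\<^sup>2))" by (simp add: exp_of_nat_mult)
    finally have "exp (- s * (1 + d) * real n) / s * C ^ n
        \<le> exp (- s * (1 + d) * real n) / s * exp (real n * (s + 4 * s\<^sup>2))"
      using s by (intro mult_left_mono) auto
    also have "\<dots> = 1 / s * exp (- s * (1 + d) * real n + real n * (s + 4 * s\<^sup>2))"
      by (simp only: exp_add) simp
    also have "- s * (1 + d) * real n + real n * (s + 4 * s\<^sup>2) = - (d\<^sup>2 / 16) * real n"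
      by (simp add: s_def power2_eq_square field_simps)
    finally show "exp (- s * (1 + d) * real n) / s * C ^ n \<le> 8 / d * exp (- (d\<^sup>2 / 16) * real n)"
      by (simp add: s_def)
  qed
  finally have int: "(\<integral>\<^sup>+\<omega>. ennreal (B \<omega>) \<partial>M) \<le> ennreal (8 / d * exp (- (d\<^sup>2 / 16) * real n))" .
  show thesis
  proof
    show "B \<in> borel_measurable M" unfolding B_def by measurable
    show "0 \<le> B \<omega>" for \<omega> using s by (simp add: B_def)
    show "(\<Sum>i=1..n. (z i \<omega>)\<^sup>2) - (1 + d) * real n \<le> B \<omega>" for \<omega>
    proof -
      have "s * ((\<Sum>i=1..n. (z i \<omega>)\<^sup>2) - (1 + d) * real n)
          \<le> exp (s * ((\<Sum>i=1..n. (z i \<omega>)\<^sup>2) - (1 + d) * real n))"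
        using exp_ge_add_one_self[of "s * ((\<Sum>i=1..n. (z i \<omega>)\<^sup>2) - (1 + d) * real n)"] by linarith
      also have "\<dots> = s * B \<omega>"
        using s by (simp add: B_def S_def exp_add[symmetric] sum_distrib_left algebra_simps)
      finally show ?thesis using s by simp
    qed
    show "(\<integral>\<^sup>+\<omega>. ennreal (B \<omega>) \<partial>M) \<le> ennreal (8 / d * exp (- (d\<^sup>2 / 16) * real n))" by (rule int)
  qed
qed

text \<open>Raising \<open>s\<close> to \<open>s'\<close> costs a factor
  \<open>exp (1 / sqrt (1 - 2 s'))\<close> per selected coordinate and gains the power
  \<open>1 - s / s'\<close> of \<open>n / k\<close>. For small \<open>k\<close> the gain wins, and
  what remains is \<open>(n / k)^k\<close>, at most the binomial coefficient.\<close>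

lemma exp_subset_sum_sparse:
  assumes "0 \<le> s" "s < s'" "s' < 1 / 2" "1 \<le> k" "k \<le> n"
    and sparse: "exp (1 / sqrt (1 - 2 * s')) \<le> (real n / real k) powr (1 - s / s')"
  obtains B :: "'a \<Rightarrow> real" where "B \<in> borel_measurable M" "\<And>\<omega>. 0 \<le> B \<omega>"
    "\<And>\<omega> J. J \<subseteq> {1..n} \<Longrightarrow> card J = k \<Longrightarrow> exp (s * (\<Sum>i\<in>J. (z i \<omega>)\<^sup>2)) \<le> B \<omega>"
    "(\<integral>\<^sup>+\<omega>. ennreal (B \<omega>) \<partial>M) \<le> ennreal (real (n choose k))"
proof -
  define A where "A = 1 / sqrt (1 - 2 * s')"
  define x where "x = real n / real k"
  \<comment> \<open>At this level \<open>exp (- s' q) = k / n\<close>, so the \<open>n\<close>-th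
    power in the general bound is at most \<open>exp A ^ k\<close>.\<close>
  define q where "q = ln x / s'"
  have s': "0 < s'" and A: "0 \<le> A" and x: "1 \<le> x" using assms by (auto simp: A_def x_def)
  have eq: "exp (- s' * q) = 1 / x" using s' x by (simp add: q_def exp_minus inverse_eq_divide)
  obtain B :: "'a \<Rightarrow> real" where B: "B \<in> borel_measurable M" "\<And>\<omega>. 0 \<le> B \<omega>"
    "\<And>\<omega> J. J \<subseteq> {1..n} \<Longrightarrow> card J = k \<Longrightarrow> exp (s * (\<Sum>i\<in>J. (z i \<omega>)\<^sup>2)) \<le> B \<omega>"
    "(\<integral>\<^sup>+\<omega>. ennreal (B \<omega>) \<partial>M)
      \<le> ennreal (exp (s * real k * q) * (1 - 0 + exp (- s' * q) / sqrt (1 - 2 * s')) ^ n)"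
    by (rule exp_subset_sum_bound[of s s' 0 q k]) (use assms in auto)
  have "exp (s * real k * q) = (x powr (s / s')) ^ k"
    using x s' by (simp add: q_def powr_def exp_of_nat_mult[symmetric] field_simps)
  moreover have "(1 - 0 + exp (- s' * q) / sqrt (1 - 2 * s')) ^ n \<le> exp A ^ k"
  proof -
    have "(1 - 0 + exp (- s' * q) / sqrt (1 - 2 * s')) ^ n = (1 + A / x) ^ n"
      by (simp only: eq A_def) (simp add: field_simps)
    also have "\<dots> \<le> exp (A / x) ^ n"
      using A x by (intro power_mono) auto
    also have "\<dots> = exp A ^ k"
      using assms by (simp add: exp_of_nat_mult[symmetric] x_def)
    finally show ?thesis .
  qed
  ultimately have "exp (s * real k * q) * (1 - 0 + exp (- s' * q) / sqrt (1 - 2 * s')) ^ n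
      \<le> (x powr (s / s')) ^ k * exp A ^ k"
    by (simp add: mult_left_mono)
  also have "\<dots> = (x powr (s / s') * exp A) ^ k" by (simp add: power_mult_distrib)
  also have "\<dots> \<le> (x powr (s / s') * x powr (1 - s / s')) ^ k"
    using sparse by (intro power_mono mult_left_mono) (auto simp: A_def x_def)
  also have "\<dots> = x ^ k" using x by (simp add: powr_add[symmetric])
  also have "\<dots> \<le> real (n choose k)"
    unfolding x_def using binomial_ge_n_over_k_pow_k[OF assms(5), where 'a = real] by simp
  finally have "(\<integral>\<^sup>+\<omega>. ennreal (B \<omega>) \<partial>M) \<le> ennreal (real (n choose k))"
    using B(4) ennreal_leI order_trans by blast
  with that[of B] B(1-3) show thesis by blast
qed

text \<open>Here both exponents equal \<open>t\<close>, and the level minimizes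
  \<open>exp (t k q) (1 + exp (- t q) w)^n\<close>. The minimum
  \<open>w^k n^n / (k^k (n - k)^(n - k))\<close> is at most \<open>n + 1\<close> times
  \<open>(n choose k) w^k\<close>, so the penalty is just matched; the gap \<open>m\<close> supplies
  the extra factor \<open>exp (- c n)\<close>.\<close>

lemma exp_subset_sum_dense:
  assumes "0 < \<gamma>" "1 \<le> k" "k < n"
    and c: "c \<le> real (n - k) / real n" "c \<le> real k / real n / sqrt (1 + \<gamma>)"
  obtains B :: "'a \<Rightarrow> real" where "B \<in> borel_measurable M" "\<And>\<omega>. 0 \<le> B \<omega>"
    "\<And>\<omega> J. J \<subseteq> {1..n} \<Longrightarrow> card J = k \<Longrightarrow>
      exp (\<gamma> / (2 * (1 + \<gamma>)) * (\<Sum>i\<in>J. (z i \<omega>)\<^sup>2)) \<le> B \<omega>"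
    "(\<integral>\<^sup>+\<omega>. ennreal (B \<omega>) \<partial>M)
      \<le> ennreal (real (n + 1) * real (n choose k) * sqrt (1 + \<gamma>) ^ k * exp (- c * real n))"
proof -
  define t where "t = \<gamma> / (2 * (1 + \<gamma>))"
  define w where "w = sqrt (1 + \<gamma>)"
  define r where "r = real k / real (n - k)"
  define m where "m = min 1 (r / w)"
  define q where "q = - ln (r / w) / t"
  have t: "0 < t" "t < 1 / 2" using assms by (auto simp: t_def field_simps)
  have w: "0 < w" using assms by (simp add: w_def)
  have tw: "1 - 2 * t = 1 / (1 + \<gamma>)" using assms by (simp add: t_def field_simps)
  have sq: "1 / sqrt (1 - 2 * t) = w" unfolding tw using assms by (simp add: w_def real_sqrt_divide)
  have r: "0 < r" using assms by (simp add: r_def)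
  have eq: "exp (- t * q) = r / w" using t r w by (simp add: q_def)
  have m: "0 \<le> m" "m \<le> 1" "m \<le> exp (- t * q)" unfolding eq using r w by (auto simp: m_def)
  obtain B :: "'a \<Rightarrow> real" where B: "B \<in> borel_measurable M" "\<And>\<omega>. 0 \<le> B \<omega>"
    "\<And>\<omega> J. J \<subseteq> {1..n} \<Longrightarrow> card J = k \<Longrightarrow> exp (t * (\<Sum>i\<in>J. (z i \<omega>)\<^sup>2)) \<le> B \<omega>"
    "(\<integral>\<^sup>+\<omega>. ennreal (B \<omega>) \<partial>M)
      \<le> ennreal (exp (t * real k * q) * (1 - m + exp (- t * q) / sqrt (1 - 2 * t)) ^ n)"
    by (rule exp_subset_sum_bound[of t t m q k]) (use t m in auto)
  have r1: "1 + r = real n / real (n - k)" using assms by (simp add: r_def field_simps of_nat_diff)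
  have "exp (t * real k * q) = (exp (t * q)) ^ k"
    by (simp add: exp_of_nat_mult[symmetric] mult_ac)
  also have "exp (t * q) = w / r"
    using eq r w by (simp add: exp_minus field_simps)
  finally have e1: "exp (t * real k * q) = (w / r) ^ k" .
  have "exp (- t * q) / sqrt (1 - 2 * t) = r / w * (1 / sqrt (1 - 2 * t))" using eq by simp
  also have "\<dots> = r" using w unfolding sq by simp
  finally have e2: "exp (- t * q) / sqrt (1 - 2 * t) = r" .
  \<comment> \<open>The two hypotheses on \<open>c\<close> correspond to the two cases of the
    minimum in \<open>m\<close>.\<close>
  have cm: "c \<le> m / (1 + r)"
  proof (cases "r / w \<le> 1")
    case True
    have "r / w / (1 + r) = real k / real n / w"
      unfolding r1 using assms by (simp add: r_def)
    then show ?thesis using True c by (simp add: m_def w_def)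
  next
    case False
    have "1 / (1 + r) = real (n - k) / real n" unfolding r1 by simp
    then show ?thesis using False c by (simp add: m_def)
  qed
  have "1 - m + r = (1 + r) * (1 - m / (1 + r))" using r by (simp add: field_simps)
  also have "\<dots> \<le> (1 + r) * exp (- c)"
    using r cm exp_ge_add_one_self[of "- (m / (1 + r))"] order_trans
    by (intro mult_left_mono) fastforce+
  finally have "(1 - m + r) ^ n \<le> ((1 + r) * exp (- c)) ^ n"
    using m r by (intro power_mono) auto
  then have "(1 - m + r) ^ n \<le> (1 + r) ^ n * exp (- c * real n)"
    by (simp add: power_mult_distrib exp_of_nat_mult[symmetric] mult.commute)
  then have "(w / r) ^ k * (1 - m + r) ^ n \<le> (w / r) ^ k * ((1 + r) ^ n * exp (- c * real n))"
    using w r by (intro mult_left_mono) auto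
  also have "\<dots> = ((1 + r) ^ n / r ^ k) * (w ^ k * exp (- c * real n))"
    by (simp add: power_divide)
  also have "\<dots> \<le> (real (n + 1) * real (n choose k)) * (w ^ k * exp (- c * real n))"
  proof (rule mult_right_mono)
    have "real (n ^ n) \<le> real ((n + 1) * ((n choose k) * k ^ k * (n - k) ^ (n - k)))"
      using binomial_mode[of k n] assms by (intro of_nat_mono) simp
    then have "real n ^ n \<le> (real (n + 1) * real (n choose k)) * (real k ^ k * real (n - k) ^ (n - k))"
      by (simp add: algebra_simps)
    moreover have "real (n - k) ^ n = real (n - k) ^ (n - k) * real (n - k) ^ k"
      using assms by (simp add: power_add[symmetric])
    ultimately show "(1 + r) ^ n / r ^ k \<le> real (n + 1) * real (n choose k)"
      unfolding r1 unfolding r_def using assms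
      by (simp add: power_divide field_simps)
  qed (use w in auto)
  finally have "exp (t * real k * q) * (1 - m + exp (- t * q) / sqrt (1 - 2 * t)) ^ n
      \<le> real (n + 1) * real (n choose k) * w ^ k * exp (- c * real n)"
    unfolding e1 e2 by (simp add: mult_ac)
  then have "(\<integral>\<^sup>+\<omega>. ennreal (B \<omega>) \<partial>M)
      \<le> ennreal (real (n + 1) * real (n choose k) * w ^ k * exp (- c * real n))"
    using B(4) ennreal_leI order_trans by blast
  with that[of B] B(1-3) show thesis unfolding w_def t_def by blast
qed

text \<open>
  \<open>excess_le b \<gamma> k p v\<close>: the amount by which the noise energy of \<open>k\<close> coordinates, inflated by
  \<open>1 + 2 b\<close>, exceeds the penalty at a prior weight \<open>p\<close> is at most \<open>v\<close> in mean, in units of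
  \<open>2 \<sigma>\<^sup>2 (1 + 1 / \<gamma>)\<close>. The dominating \<open>B\<close> avoids any measurability question for the selector.
\<close>

definition excess_le :: "real \<Rightarrow> real \<Rightarrow> nat \<Rightarrow> real \<Rightarrow> real \<Rightarrow> bool"
  where "excess_le b \<gamma> k p v \<longleftrightarrow> (\<exists>B\<in>borel_measurable M. (\<forall>\<omega>. 0 \<le> B \<omega>) \<and>
    (\<forall>\<omega> J. J \<subseteq> {1..n} \<longrightarrow> card J = k \<longrightarrow>
      (1 + 2 * b) * (\<gamma> / (2 * (1 + \<gamma>))) * (\<Sum>i\<in>J. (z i \<omega>)\<^sup>2)
        - ln (real (n choose k) * inverse p * (1 + \<gamma>) powr (real k / 2)) \<le> B \<omega>) \<and>
    (\<integral>\<^sup>+\<omega>. ennreal (B \<omega>) \<partial>M) \<le> ennreal v)"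

section \<open>Excess over the penalty at sparse, intermediate and nearly full sizes\<close>

lemma excess_le_mono: "excess_le b \<gamma> k p v \<Longrightarrow> v \<le> v' \<Longrightarrow> excess_le b \<gamma> k p v'"
  unfolding excess_le_def by (meson ennreal_leI order_trans)

text \<open>The inflated exponent stays below some \<open>s' < 1 / 2\<close>, so the exponential has
  mean at most \<open>n choose k\<close>. The penalty contributes a factor at most
  \<open>p / (n choose k)\<close>, and \<open>p\<close> remains, which can be summed over the
  sizes.\<close>

lemma excess_le_sparse:
  assumes "0 < \<gamma>" "0 \<le> b" "8 * b * \<gamma> \<le> 1" "1 \<le> k" "k \<le> n" "0 < p"
    and sparse: "exp (2 * (1 + 2 * \<gamma>) * sqrt (2 * (1 + \<gamma>))) \<le> real n / real k"
  shows "excess_le b \<gamma> k p p"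
proof -
  define s where "s = (1 + 2 * b) * (\<gamma> / (2 * (1 + \<gamma>)))"
  \<comment> \<open>The midpoint between \<open>\<gamma> / (2 (1 + \<gamma>))\<close> and
    \<open>1 / 2\<close>.\<close>
  define s' where "s' = (1 + 2 * \<gamma>) / (4 * (1 + \<gamma>))"
  define C where "C = real (n choose k)"
  have C: "0 < C" using assms by (simp add: C_def)
  have s: "0 \<le> s" using assms by (simp add: s_def)
  have s': "s' < 1 / 2" "0 < s'" using assms by (auto simp: s'_def field_simps)
  have "s / s' = (2 * \<gamma> + 4 * b * \<gamma>) / (1 + 2 * \<gamma>)"
    using assms by (simp add: s_def s'_def divide_simps) (simp add: algebra_simps)
  \<comment> \<open>Without inflation the ratio is \<open>1 - 1 / (1 + 2 \<gamma>)\<close>; the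
    condition \<open>8 b \<gamma> \<le> 1\<close> lets the inflation use up at most half of this
    distance from 1.\<close>
  also have "\<dots> \<le> (2 * \<gamma> + 1 / 2) / (1 + 2 * \<gamma>)"
    using assms by (intro divide_right_mono) auto
  also have "\<dots> = 1 - 1 / (2 * (1 + 2 * \<gamma>))"
    using assms by (simp add: field_simps)
  finally have ratio: "1 / (2 * (1 + 2 * \<gamma>)) \<le> 1 - s / s'" by simp
  moreover have "0 < 1 / (2 * (1 + 2 * \<gamma>))" using assms by simp
  ultimately have "s / s' < 1" by linarith
  then have ss': "s < s'" using s' by simp
  have "1 - 2 * s' = 1 / (2 * (1 + \<gamma>))" using assms by (simp add: s'_def field_simps)
  then have "1 / sqrt (1 - 2 * s') = sqrt (2 * (1 + \<gamma>))" by (simp add: real_sqrt_divide)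
  then have "exp (1 / sqrt (1 - 2 * s'))
      = exp (2 * (1 + 2 * \<gamma>) * sqrt (2 * (1 + \<gamma>))) powr (1 / (2 * (1 + 2 * \<gamma>)))"
    using assms by (simp add: powr_def)
  also have "\<dots> \<le> (real n / real k) powr (1 / (2 * (1 + 2 * \<gamma>)))"
    using sparse assms by (intro powr_mono2) auto
  also have "\<dots> \<le> (real n / real k) powr (1 - s / s')"
    using ratio assms by (intro powr_mono) auto
  finally have sp: "exp (1 / sqrt (1 - 2 * s')) \<le> (real n / real k) powr (1 - s / s')" .
  obtain B :: "'a \<Rightarrow> real" where B: "B \<in> borel_measurable M" "\<And>\<omega>. 0 \<le> B \<omega>"
    "\<And>\<omega> J. J \<subseteq> {1..n} \<Longrightarrow> card J = k \<Longrightarrow> exp (s * (\<Sum>i\<in>J. (z i \<omega>)\<^sup>2)) \<le> B \<omega>"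
    "(\<integral>\<^sup>+\<omega>. ennreal (B \<omega>) \<partial>M) \<le> ennreal C"
    using exp_subset_sum_sparse[OF s ss' s'(1) assms(4,5) sp] unfolding C_def by blast
  have [measurable]: "B \<in> borel_measurable M" by (rule B(1))
  show ?thesis unfolding excess_le_def
  proof (intro bexI[of _ "\<lambda>\<omega>. p / C * B \<omega>"] conjI allI impI)
    fix \<omega> J assume J: "J \<subseteq> {1..n}" "card J = k"
    define G where "G = C * inverse p * (1 + \<gamma>) powr (real k / 2)"
    have G: "0 < G" using C assms by (simp add: G_def)
    have "1 \<le> (1 + \<gamma>) powr (real k / 2)" using assms by (intro ge_one_powr_ge_zero) auto
    then have GC: "C / p \<le> G" using C assms by (simp add: G_def field_simps)
    have "s * (\<Sum>i\<in>J. (z i \<omega>)\<^sup>2) - ln G \<le> exp (s * (\<Sum>i\<in>J. (z i \<omega>)\<^sup>2) - ln G)"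
      using exp_ge_add_one_self[of "s * (\<Sum>i\<in>J. (z i \<omega>)\<^sup>2) - ln G"] by linarith
    also have "\<dots> = exp (s * (\<Sum>i\<in>J. (z i \<omega>)\<^sup>2)) / G" using G by (simp add: exp_diff)
    also have "\<dots> \<le> B \<omega> / G" using B(3)[OF J] G by (simp add: divide_right_mono)
    also have "\<dots> \<le> B \<omega> / (C / p)" using GC B(2) C assms G by (intro divide_left_mono) auto
    finally show "(1 + 2 * b) * (\<gamma> / (2 * (1 + \<gamma>))) * (\<Sum>i\<in>J. (z i \<omega>)\<^sup>2)
        - ln (real (n choose k) * inverse p * (1 + \<gamma>) powr (real k / 2)) \<le> p / C * B \<omega>"
      by (simp add: s_def G_def C_def mult.commute)
  next
    have "(\<integral>\<^sup>+\<omega>. ennreal (p / C * B \<omega>) \<partial>M) = ennreal (p / C) * (\<integral>\<^sup>+\<omega>. ennreal (B \<omega>) \<partial>M)"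
      using C assms by (simp add: ennreal_mult' nn_integral_cmult del: times_divide_eq_left)
    also have "\<dots> \<le> ennreal (p / C) * ennreal C" by (intro mult_left_mono B) auto
    also have "\<dots> = ennreal p" using C assms by (simp add: ennreal_mult'[symmetric])
    finally show "(\<integral>\<^sup>+\<omega>. ennreal (p / C * B \<omega>) \<partial>M) \<le> ennreal p" .
  qed (use B C assms in auto)
qed

text \<open>The exponent \<open>t\<close> leaves no room for the inflation inside the exponential.
  Half of the gain \<open>exp (- c n)\<close> therefore stays in the mean, while the other half pays
  for the extra term \<open>2 b t X\<close>, whose typical size is a small multiple of
  \<open>n\<close>.\<close>

lemma excess_le_dense:
  assumes "0 < \<gamma>" "1 \<le> k" "k < n" "0 < p" "p \<le> 1" "0 \<le> b" "4 * b \<le> c" "0 < d" "d \<le> 1"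
    and c: "c \<le> real (n - k) / real n" "c \<le> real k / real n / sqrt (1 + \<gamma>)"
  shows "excess_le b \<gamma> k p (real (n + 1) * exp (- (c / 2) * real n) + 8 / d * exp (- (d\<^sup>2 / 16) * real n))"
proof -
  define t where "t = \<gamma> / (2 * (1 + \<gamma>))"
  define G where "G = real (n choose k) * sqrt (1 + \<gamma>) ^ k"
  define S where "S \<omega> = (\<Sum>i=1..n. (z i \<omega>)\<^sup>2)" for \<omega>
  have t: "0 < t" "t < 1 / 2" using assms by (auto simp: t_def field_simps)
  have G: "0 < G" using assms by (simp add: G_def)
  obtain B :: "'a \<Rightarrow> real" where B: "B \<in> borel_measurable M" "\<And>\<omega>. 0 \<le> B \<omega>"
    "\<And>\<omega> J. J \<subseteq> {1..n} \<Longrightarrow> card J = k \<Longrightarrow> exp (t * (\<Sum>i\<in>J. (z i \<omega>)\<^sup>2)) \<le> B \<omega>"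
    "(\<integral>\<^sup>+\<omega>. ennreal (B \<omega>) \<partial>M) \<le> ennreal (real (n + 1) * G * exp (- c * real n))"
    using exp_subset_sum_dense[OF assms(1-3) c] unfolding t_def G_def by (metis mult.assoc)
  obtain D :: "'a \<Rightarrow> real" where D: "D \<in> borel_measurable M" "\<And>\<omega>. 0 \<le> D \<omega>"
    "\<And>\<omega>. S \<omega> - (1 + d) * real n \<le> D \<omega>"
    "(\<integral>\<^sup>+\<omega>. ennreal (D \<omega>) \<partial>M) \<le> ennreal (8 / d * exp (- (d\<^sup>2 / 16) * real n))"
    using square_sum_concentration[OF assms(8,9)] unfolding S_def by blast
  have [measurable]: "B \<in> borel_measurable M" "D \<in> borel_measurable M" by (rule B D)+
  define a where "a = exp (c / 2 * real n) / G"
  have a: "0 < a" using G by (simp add: a_def)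
  show ?thesis unfolding excess_le_def
  proof (intro bexI[of _ "\<lambda>\<omega>. a * B \<omega> + D \<omega>"] conjI allI impI)
    fix \<omega> J assume J: "J \<subseteq> {1..n}" "card J = k"
    have pw: "(1 + \<gamma>) powr (real k / 2) = sqrt (1 + \<gamma>) ^ k"
      using assms by (simp add: powr_half_sqrt[symmetric] powr_powr powr_realpow[symmetric])
    have "ln G \<le> ln (G * inverse p)"
      using G assms by (intro ln_mono) (auto simp: field_simps)
    also have "G * inverse p = real (n choose k) * inverse p * (1 + \<gamma>) powr (real k / 2)"
      by (simp add: G_def pw mult_ac)
    finally have lnG: "ln G \<le> ln (real (n choose k) * inverse p * (1 + \<gamma>) powr (real k / 2))" .
    define X where "X = (\<Sum>i\<in>J. (z i \<omega>)\<^sup>2)"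
    have XS: "X \<le> S \<omega>" unfolding X_def S_def using J by (intro sum_mono2) auto
    have "t * X - ln G + c / 2 * real n \<le> exp (t * X - ln G + c / 2 * real n)"
      using exp_ge_add_one_self[of "t * X - ln G + c / 2 * real n"] by linarith
    also have "\<dots> = a * exp (t * X)"
      using G by (simp add: a_def exp_diff exp_add)
    also have "\<dots> \<le> a * B \<omega>" using B(3)[OF J] a by (simp add: X_def)
    finally have 1: "t * X - ln G + c / 2 * real n \<le> a * B \<omega>" .
    have "b * t \<le> b * (1 / 2)" using t assms by (intro mult_left_mono) auto
    then have bt: "0 \<le> 2 * b * t" "4 * (b * t) \<le> c / 2" "2 * (b * t) \<le> 1"
    proof -
      have "c \<le> 1" using c(1) assms by (simp add: order_trans[OF c(1)])
      then show "2 * (b * t) \<le> 1" using \<open>b * t \<le> b * (1 / 2)\<close> assms by linarith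
    qed (use t assms \<open>b * t \<le> b * (1 / 2)\<close> in auto)
    \<comment> \<open>Because \<open>4 b t \<le> c / 2\<close>, the amount \<open>c n / 2\<close>
      covers \<open>2 b t\<close> times the energy \<open>2 n\<close>; only the deviation of
      \<open>S\<close> above \<open>2 n\<close> is left.\<close>
    have "2 * b * t * X - c / 2 * real n \<le> 2 * b * t * S \<omega> - 4 * (b * t) * real n"
      using bt XS by (intro diff_mono mult_left_mono mult_right_mono) auto
    also have "\<dots> = 2 * b * t * (S \<omega> - 2 * real n)" by (simp add: algebra_simps)
    also have "\<dots> \<le> 2 * b * t * D \<omega>"
    proof (intro mult_left_mono bt)
      have "(1 + d) * real n \<le> 2 * real n" using assms by (intro mult_right_mono) auto
      then show "S \<omega> - 2 * real n \<le> D \<omega>" using D(3)[of \<omega>] by linarith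
    qed
    also have "\<dots> \<le> 1 * D \<omega>" using bt D(2) by (intro mult_right_mono) auto
    finally have 2: "2 * b * t * X - c / 2 * real n \<le> D \<omega>" by simp
    have "(1 + 2 * b) * t * X = t * X + 2 * b * t * X" by (simp add: algebra_simps)
    then show "(1 + 2 * b) * (\<gamma> / (2 * (1 + \<gamma>))) * (\<Sum>i\<in>J. (z i \<omega>)\<^sup>2)
        - ln (real (n choose k) * inverse p * (1 + \<gamma>) powr (real k / 2)) \<le> a * B \<omega> + D \<omega>"
      using 1 2 lnG unfolding t_def[symmetric] X_def[symmetric] by linarith
  next
    have "(\<integral>\<^sup>+\<omega>. ennreal (a * B \<omega> + D \<omega>) \<partial>M)
        = ennreal a * (\<integral>\<^sup>+\<omega>. ennreal (B \<omega>) \<partial>M) + (\<integral>\<^sup>+\<omega>. ennreal (D \<omega>) \<partial>M)"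
      using a B(2) D(2) by (simp add: ennreal_mult' nn_integral_cmult nn_integral_add)
    also have "\<dots> \<le> ennreal a * ennreal (real (n + 1) * G * exp (- c * real n))
        + ennreal (8 / d * exp (- (d\<^sup>2 / 16) * real n))"
      by (intro add_mono mult_left_mono B D) auto
    also have "\<dots> = ennreal (a * (real (n + 1) * G * exp (- c * real n)) + 8 / d * exp (- (d\<^sup>2 / 16) * real n))"
      using a G assms by (simp add: ennreal_mult'[symmetric] ennreal_plus[symmetric] del: ennreal_plus)
    also have "a * (real (n + 1) * G * exp (- c * real n)) = real (n + 1) * (exp (c / 2 * real n) * exp (- c * real n))"
      using G by (simp add: a_def)
    also have "exp (c / 2 * real n) * exp (- c * real n) = exp (- (c / 2) * real n)"
      by (simp add: exp_add[symmetric])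
    finally show "(\<integral>\<^sup>+\<omega>. ennreal (a * B \<omega> + D \<omega>) \<partial>M)
        \<le> ennreal (real (n + 1) * exp (- (c / 2) * real n) + 8 / d * exp (- (d\<^sup>2 / 16) * real n))" by simp
  qed (use B D a in auto)
qed

text \<open>Near full size the term \<open>(k / 2) ln (1 + \<gamma>)\<close> alone exceeds
  \<open>t\<close> times the inflated energy level \<open>(1 + 2 b) (1 + d) n\<close>, so only the
  deviation of the total energy from its level remains.\<close>

lemma excess_le_full:
  assumes "0 < \<gamma>" "k \<le> n" "0 < p" "p \<le> 1" "0 \<le> b" "b \<le> 1 / 2" "0 < d" "d \<le> 1"
    and full: "(1 + 2 * b) * (1 + d) * real n \<le> real k * (1 + \<gamma> / (2 + \<gamma>))"
  shows "excess_le b \<gamma> k p (8 / d * exp (- (d\<^sup>2 / 16) * real n))"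
proof -
  define t where "t = \<gamma> / (2 * (1 + \<gamma>))"
  define S where "S \<omega> = (\<Sum>i=1..n. (z i \<omega>)\<^sup>2)" for \<omega>
  have t: "0 < t" "t < 1 / 2" using assms by (auto simp: t_def field_simps)
  obtain D :: "'a \<Rightarrow> real" where D: "D \<in> borel_measurable M" "\<And>\<omega>. 0 \<le> D \<omega>"
    "\<And>\<omega>. S \<omega> - (1 + d) * real n \<le> D \<omega>"
    "(\<integral>\<^sup>+\<omega>. ennreal (D \<omega>) \<partial>M) \<le> ennreal (8 / d * exp (- (d\<^sup>2 / 16) * real n))"
    using square_sum_concentration[OF assms(7,8)] unfolding S_def by blast
  show ?thesis unfolding excess_le_def
  proof (intro bexI[of _ D] conjI allI impI)
    fix \<omega> J assume J: "J \<subseteq> {1..n}" "card J = k"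
    define X where "X = (\<Sum>i\<in>J. (z i \<omega>)\<^sup>2)"
    have XS: "X \<le> S \<omega>" unfolding X_def S_def using J by (intro sum_mono2) auto
    have "t * ((1 + 2 * b) * (1 + d) * real n) \<le> t * (real k * (1 + \<gamma> / (2 + \<gamma>)))"
      using full t by (intro mult_left_mono) auto
    also have "\<dots> = real k / 2 * (2 * \<gamma> / (2 + \<gamma>))"
      using assms by (simp add: t_def divide_simps)
    also have "\<dots> \<le> real k / 2 * ln (1 + \<gamma>)"
      using ln_one_plus_ge[of \<gamma>] assms by (intro mult_left_mono) auto
    also have "\<dots> = ln ((1 + \<gamma>) powr (real k / 2))"
      using assms by (simp add: ln_powr)
    also have "\<dots> \<le> ln (real (n choose k) * inverse p * (1 + \<gamma>) powr (real k / 2))"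
    proof (rule ln_mono)
      have "1 \<le> real (n choose k)" using assms by (simp add: Suc_le_eq)
      moreover have "1 \<le> inverse p" using assms by (simp add: one_le_inverse)
      ultimately have "1 * 1 \<le> real (n choose k) * inverse p" by (intro mult_mono) auto
      then show "(1 + \<gamma>) powr (real k / 2) \<le> real (n choose k) * inverse p * (1 + \<gamma>) powr (real k / 2)"
        using mult_right_mono[of 1 "real (n choose k) * inverse p" "(1 + \<gamma>) powr (real k / 2)"] by simp
    qed (use assms in auto)
    finally have "t * ((1 + 2 * b) * (1 + d) * real n)
      \<le> ln (real (n choose k) * inverse p * (1 + \<gamma>) powr (real k / 2))" .
    moreover have "(1 + 2 * b) * t * X \<le> (1 + 2 * b) * t * S \<omega>"
      using XS t assms by (intro mult_left_mono) auto
    moreover have "(1 + 2 * b) * t * S \<omega> - t * ((1 + 2 * b) * (1 + d) * real n)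
        = (1 + 2 * b) * t * (S \<omega> - (1 + d) * real n)" by (simp add: algebra_simps)
    moreover have "(1 + 2 * b) * t * (S \<omega> - (1 + d) * real n) \<le> (1 + 2 * b) * t * D \<omega>"
      using D(3)[of \<omega>] t assms by (intro mult_left_mono) auto
    moreover have "(1 + 2 * b) * t * D \<omega> \<le> 1 * D \<omega>"
    proof (rule mult_right_mono)
      have "(1 + 2 * b) * t \<le> 2 * (1 / 2)" using t assms by (intro mult_mono) auto
      then show "(1 + 2 * b) * t \<le> 1" by simp
    qed (rule D)
    ultimately show "(1 + 2 * b) * (\<gamma> / (2 * (1 + \<gamma>))) * (\<Sum>i\<in>J. (z i \<omega>)\<^sup>2)
        - ln (real (n choose k) * inverse p * (1 + \<gamma>) powr (real k / 2)) \<le> D \<omega>"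
      unfolding t_def[symmetric] X_def[symmetric] by linarith
  qed (use D in auto)
qed

end

text \<open>The three excess bounds cover every size uniformly in \<open>\<gamma>\<close>: the
  sparse one up to \<open>\<epsilon> n\<close>, with \<open>\<epsilon>\<close> taken at the worst
  case \<open>hi\<close>, and the full one beyond \<open>(1 - d) n\<close>, with \<open>d\<close>
  taken at the worst case \<open>lo\<close>. In between, \<open>e\<close> is a gain valid for all
  sizes.\<close>

lemma excess_constants:
  fixes lo hi :: real
  assumes "0 < lo" "lo \<le> hi"
  obtains b c K :: real where "0 < b" "b \<le> 1 / 2" "0 < c" "0 < K"
    "\<And>(M :: 'a measure) n z \<gamma> k p. gaussian_noise M n z \<Longrightarrow> lo \<le> \<gamma> \<Longrightarrow> \<gamma> \<le> hi \<Longrightarrow> 1 \<le> k \<Longrightarrow> k \<le> n \<Longrightarrow>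
      0 < p \<Longrightarrow> p \<le> 1 \<Longrightarrow>
      gaussian_noise.excess_le M n z b \<gamma> k p (p + K * (real n + 1) * exp (- c * real n))"
proof -
  define \<epsilon> where "\<epsilon> = exp (- (2 * (1 + 2 * hi) * sqrt (2 * (1 + hi))))"
  \<comment> \<open>A quarter of the margin \<open>lo / (2 + lo)\<close>: then
    \<open>(1 + d / 2) (1 + d) \<le> (1 - d) (1 + 4 d)\<close> pays at once for the inflation, the
    deviation and the at most \<open>d n\<close> unselected coordinates.\<close>
  define d where "d = lo / (2 + lo) / 4"
  define e where "e = min d (\<epsilon> / sqrt (1 + hi))"
  define b where "b = min (min (1 / 2) (1 / (8 * hi))) (min (d / 4) (e / 4))"
  define c where "c = min (e / 2) (d\<^sup>2 / 16)"
  define K where "K = 1 + 8 / d"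
  have d: "0 < d" "4 * d \<le> 1" using assms by (auto simp: d_def field_simps)
  have e: "0 < e" "e \<le> d" "e \<le> \<epsilon> / sqrt (1 + hi)" using d assms by (auto simp: e_def \<epsilon>_def)
  have b: "0 < b" "b \<le> 1 / 2" "b \<le> 1 / (8 * hi)" "b \<le> d / 4" "b \<le> e / 4"
    using d e assms by (auto simp: b_def)
  have c: "0 < c" "c \<le> e / 2" "c \<le> d\<^sup>2 / 16" using d e by (auto simp: c_def)
  have K: "0 < K" using d by (simp add: K_def add_pos_pos)
  show thesis
  proof (rule that[OF b(1,2) c(1) K])
    fix M :: "'a measure" and n z \<gamma> k and p :: real
    assume "gaussian_noise M n z" and \<gamma>: "lo \<le> \<gamma>" "\<gamma> \<le> hi" and k: "1 \<le> k" "k \<le> n" and p: "0 < p" "p \<le> 1"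
    interpret gaussian_noise M n z by fact
    have \<gamma>0: "0 < \<gamma>" using \<gamma> assms by simp
    have n: "0 < real n" using k by simp
    have exps: "exp (- (e / 2) * real n) \<le> exp (- c * real n)"
      "exp (- (d\<^sup>2 / 16) * real n) \<le> exp (- c * real n)"
      using c n by (auto intro!: mult_right_mono)
    have conc: "8 / d * exp (- (d\<^sup>2 / 16) * real n) \<le> 8 / d * (real n + 1) * exp (- c * real n)"
    proof -
      have "8 / d * exp (- (d\<^sup>2 / 16) * real n) \<le> 8 / d * exp (- c * real n)"
        using d exps by (intro mult_left_mono) auto
      also have "\<dots> \<le> 8 / d * (real n + 1) * exp (- c * real n)"
        using d n by (intro mult_right_mono) (auto simp: field_simps)
      finally show ?thesis .
    qed
    consider "real k \<le> \<epsilon> * real n" | "\<epsilon> * real n < real k" "real k \<le> (1 - d) * real n"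
      | "(1 - d) * real n < real k" by linarith
    then show "excess_le b \<gamma> k p (p + K * (real n + 1) * exp (- c * real n))"
    proof cases
      case 1
      have "8 * b * \<gamma> \<le> 8 * (1 / (8 * hi)) * hi"
        using b \<gamma> \<gamma>0 by (intro mult_mono) auto
      moreover have "exp (2 * (1 + 2 * \<gamma>) * sqrt (2 * (1 + \<gamma>))) \<le> exp (2 * (1 + 2 * hi) * sqrt (2 * (1 + hi)))"
        using \<gamma> \<gamma>0 by (intro exp_mono mult_mono) auto
      moreover have "exp (2 * (1 + 2 * hi) * sqrt (2 * (1 + hi))) \<le> real n / real k"
      proof -
        define E where "E = exp (2 * (1 + 2 * hi) * sqrt (2 * (1 + hi)))"
        have "\<epsilon> = inverse E" "0 < E" by (simp_all only: \<epsilon>_def E_def exp_minus exp_gt_zero)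
        then have "E * real k \<le> E * (\<epsilon> * real n)" "E * \<epsilon> = 1"
          using 1 by simp_all
        then have "E * real k \<le> real n" by (simp flip: mult.assoc)
        then have "E \<le> real n / real k" using k by (simp add: field_simps)
        then show ?thesis by (simp only: E_def)
      qed
      ultimately have "8 * b * \<gamma> \<le> 1" "exp (2 * (1 + 2 * \<gamma>) * sqrt (2 * (1 + \<gamma>))) \<le> real n / real k"
        using assms by (simp, linarith)
      then have "excess_le b \<gamma> k p p"
        using \<gamma>0 b(1) k p by (intro excess_le_sparse) simp_all
      then show ?thesis
        by (rule excess_le_mono) (use K in auto)
    next
      case 2
      have "(1 - d) * real n < 1 * real n" using d n by (intro mult_strict_right_mono) auto
      then have kn: "k < n" using 2 by simp
      have "d \<le> real (n - k) / real n" using 2 n kn by (simp add: field_simps of_nat_diff)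
      then have e1: "e \<le> real (n - k) / real n" using e by linarith
      have "\<epsilon> / sqrt (1 + hi) \<le> real k / real n / sqrt (1 + \<gamma>)"
        using 2 \<gamma> \<gamma>0 n by (intro frac_le) (auto simp: field_simps)
      then have e2: "e \<le> real k / real n / sqrt (1 + \<gamma>)" using e by linarith
      have "excess_le b \<gamma> k p (real (n + 1) * exp (- (e / 2) * real n) + 8 / d * exp (- (d\<^sup>2 / 16) * real n))"
        using \<gamma>0 k kn p b d e1 e2 by (intro excess_le_dense) auto
      moreover have "real (n + 1) * exp (- (e / 2) * real n) \<le> 1 * (real n + 1) * exp (- c * real n)"
        using exps mult_left_mono[OF exps(1), of "real n + 1"] by (simp add: add.commute)
      ultimately show ?thesis
        by (elim excess_le_mono) (use conc p in \<open>simp add: K_def algebra_simps\<close>)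
    next
      case 3
      have "4 * d \<le> \<gamma> / (2 + \<gamma>)"
        using \<gamma> assms \<gamma>0 by (simp add: d_def divide_simps) (simp add: algebra_simps)
      have "(1 + 2 * b) * (1 + d) \<le> (1 + d / 2) * (1 + d)"
        using b d by (intro mult_right_mono) auto
      also have "\<dots> \<le> (1 - d) * (1 + 4 * d)"
      proof -
        have "4 * (d * d) \<le> 1 * d" using d mult_right_mono[of "4 * d" 1 d] by simp
        moreover have "(1 - d) * (1 + 4 * d) - (1 + d / 2) * (1 + d) = 3 / 2 * d - 9 / 2 * (d * d)"
          by (simp add: field_simps)
        ultimately show ?thesis using d by linarith
      qed
      also have "\<dots> \<le> (1 - d) * (1 + \<gamma> / (2 + \<gamma>))"
        using \<open>4 * d \<le> \<gamma> / (2 + \<gamma>)\<close> d by (intro mult_left_mono) auto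
      finally have "(1 + 2 * b) * (1 + d) * real n \<le> (1 - d) * (1 + \<gamma> / (2 + \<gamma>)) * real n"
        using n by (intro mult_right_mono) auto
      also have "\<dots> = ((1 - d) * real n) * (1 + \<gamma> / (2 + \<gamma>))" by simp
      also have "\<dots> \<le> real k * (1 + \<gamma> / (2 + \<gamma>))"
        using 3 \<gamma>0 by (intro mult_right_mono) auto
      finally have "excess_le b \<gamma> k p (8 / d * exp (- (d\<^sup>2 / 16) * real n))"
        using \<gamma>0 k p b d by (intro excess_le_full) auto
      then show ?thesis
      proof (rule excess_le_mono)
        have "8 / d * (real n + 1) * exp (- c * real n) \<le> K * (real n + 1) * exp (- c * real n)"
          using n by (intro mult_right_mono) (auto simp: K_def)
        then show "8 / d * exp (- (d\<^sup>2 / 16) * real n) \<le> p + K * (real n + 1) * exp (- c * real n)"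
          using conc p by linarith
      qed
    qed
  qed
qed

section \<open>Oracle inequality\<close>

text \<open>After cancelling common squares, \<open>T - S\<close> stands against
  \<open>S - T\<close>. On \<open>T - S\<close> Young's inequality puts \<open>1 + b\<close> on the
  noise, and adding \<open>b\<close> times the noise loss makes \<open>1 + 2 b\<close>. On
  \<open>S - T\<close> half of the signal survives, which covers \<open>b\<close> times the missed
  signal as \<open>b \<le> 1 / 2\<close>.\<close>

lemma selection_loss_bound:
  fixes y \<mu> \<epsilon> :: "nat \<Rightarrow> real"
  assumes I: "finite I" "T \<subseteq> I" "S \<subseteq> I" and b: "0 < b" "b \<le> 1 / 2"
    and y: "\<And>i. i \<in> I \<Longrightarrow> y i = \<mu> i + \<epsilon> i"
    and le: "(\<Sum>i\<in>I - T. (y i)\<^sup>2) + P' \<le> (\<Sum>i\<in>I - S. (y i)\<^sup>2) + P"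
  shows "b * ((\<Sum>i\<in>T. (\<epsilon> i)\<^sup>2) + (\<Sum>i\<in>I - T. (\<mu> i)\<^sup>2))
    \<le> (\<Sum>i\<in>S. (\<epsilon> i)\<^sup>2) + P + (2 + 1 / b) * (\<Sum>i\<in>I - S. (\<mu> i)\<^sup>2) + ((1 + 2 * b) * (\<Sum>i\<in>T. (\<epsilon> i)\<^sup>2) - P')"
proof -
  have fin: "finite T" "finite S" using I finite_subset by blast+
  have split: "sum f (I - A) = sum f (I - (A \<union> B)) + sum f (B - A)" if "A \<subseteq> I" "B \<subseteq> I"
    for A B and f :: "nat \<Rightarrow> real"
  proof -
    have "I - A = (I - (A \<union> B)) \<union> (B - A)" "(I - (A \<union> B)) \<inter> (B - A) = {}" using that by auto
    then show ?thesis using I(1) that finite_subset[OF that(2) I(1)] by (metis finite_Diff sum.union_disjoint)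
  qed
  have nonneg: "0 \<le> (\<Sum>i\<in>A. (f i)\<^sup>2)" for A and f :: "nat \<Rightarrow> real" by (simp add: sum_nonneg)
  have mono: "(\<Sum>i\<in>A. (f i)\<^sup>2) \<le> (\<Sum>i\<in>B. (f i)\<^sup>2)" if "A \<subseteq> B" "B \<subseteq> I" for A B and f :: "nat \<Rightarrow> real"
    using that I(1) finite_subset[OF that(2) I(1)] by (intro sum_mono2) auto
  have upper: "(\<Sum>i\<in>T - S. (y i)\<^sup>2) \<le> (1 + b) * (\<Sum>i\<in>T. (\<epsilon> i)\<^sup>2) + (1 + 1 / b) * (\<Sum>i\<in>I - S. (\<mu> i)\<^sup>2)"
  proof -
    have "(\<Sum>i\<in>T - S. (y i)\<^sup>2) \<le> (\<Sum>i\<in>T - S. (1 + b) * (\<epsilon> i)\<^sup>2 + (1 + 1 / b) * (\<mu> i)\<^sup>2)"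
    proof (rule sum_mono)
      fix i assume "i \<in> T - S"
      then have "y i = \<mu> i + \<epsilon> i" using y I by auto
      moreover have "0 \<le> (b * \<epsilon> i - \<mu> i)\<^sup>2 / b" using b by simp
      moreover have "(b * \<epsilon> i - \<mu> i)\<^sup>2 / b = b * (\<epsilon> i)\<^sup>2 - 2 * \<mu> i * \<epsilon> i + (\<mu> i)\<^sup>2 / b"
        using b by (simp add: power2_eq_square field_simps)
      ultimately show "(y i)\<^sup>2 \<le> (1 + b) * (\<epsilon> i)\<^sup>2 + (1 + 1 / b) * (\<mu> i)\<^sup>2"
        by (simp add: power2_sum algebra_simps)
    qed
    also have "\<dots> = (1 + b) * (\<Sum>i\<in>T - S. (\<epsilon> i)\<^sup>2) + (1 + 1 / b) * (\<Sum>i\<in>T - S. (\<mu> i)\<^sup>2)"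
      by (simp add: sum.distrib sum_distrib_left)
    also have "\<dots> \<le> (1 + b) * (\<Sum>i\<in>T. (\<epsilon> i)\<^sup>2) + (1 + 1 / b) * (\<Sum>i\<in>I - S. (\<mu> i)\<^sup>2)"
      using b I by (intro add_mono mult_left_mono mono) auto
    finally show ?thesis .
  qed
  have lower: "(\<Sum>i\<in>S - T. (\<mu> i)\<^sup>2) / 2 - (\<Sum>i\<in>S. (\<epsilon> i)\<^sup>2) \<le> (\<Sum>i\<in>S - T. (y i)\<^sup>2)"
  proof -
    have "(\<Sum>i\<in>S - T. (\<mu> i)\<^sup>2) / 2 - (\<Sum>i\<in>S - T. (\<epsilon> i)\<^sup>2) = (\<Sum>i\<in>S - T. (\<mu> i)\<^sup>2 / 2 - (\<epsilon> i)\<^sup>2)"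
      by (simp add: sum_subtractf sum_divide_distrib)
    also have "\<dots> \<le> (\<Sum>i\<in>S - T. (y i)\<^sup>2)"
    proof (rule sum_mono)
      fix i assume "i \<in> S - T"
      then have "y i = \<mu> i + \<epsilon> i" using y I by auto
      moreover have "0 \<le> (\<mu> i + 2 * \<epsilon> i)\<^sup>2 / 2" by simp
      ultimately show "(\<mu> i)\<^sup>2 / 2 - (\<epsilon> i)\<^sup>2 \<le> (y i)\<^sup>2"
        by (simp add: power2_eq_square algebra_simps)
    qed
    finally show ?thesis using mono[of "S - T" S \<epsilon>] I by auto
  qed
  have basic: "(\<Sum>i\<in>S - T. (y i)\<^sup>2) + P' \<le> (\<Sum>i\<in>T - S. (y i)\<^sup>2) + P"
    using le split[OF I(2,3), of "\<lambda>i. (y i)\<^sup>2"] split[OF I(3,2), of "\<lambda>i. (y i)\<^sup>2"]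
    by (simp add: Un_commute)
  have "b * (\<Sum>i\<in>I - T. (\<mu> i)\<^sup>2) \<le> b * ((\<Sum>i\<in>S - T. (\<mu> i)\<^sup>2) + (\<Sum>i\<in>I - S. (\<mu> i)\<^sup>2))"
    using split[OF I(2,3), of "\<lambda>i. (\<mu> i)\<^sup>2"] mono[of "I - (T \<union> S)" "I - S" \<mu>] b by auto
  also have "\<dots> \<le> 1 / 2 * ((\<Sum>i\<in>S - T. (\<mu> i)\<^sup>2) + (\<Sum>i\<in>I - S. (\<mu> i)\<^sup>2))"
    using b nonneg by (intro mult_right_mono add_nonneg_nonneg) auto
  finally have "b * (\<Sum>i\<in>I - T. (\<mu> i)\<^sup>2) \<le> (\<Sum>i\<in>S - T. (\<mu> i)\<^sup>2) / 2 + (\<Sum>i\<in>I - S. (\<mu> i)\<^sup>2) / 2"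
    by simp
  then show ?thesis using basic upper lower nonneg[of \<mu> "I - S"]
    by (simp add: algebra_simps)
qed

lemma map_penalty_nonneg:
  assumes "0 < \<gamma>" "k \<le> n" "k \<in> set_pmf \<pi>"
  shows "0 \<le> map_penalty n \<sigma> \<gamma> \<pi> k"
proof -
  have "1 \<le> real (n choose k)" using assms by (simp add: Suc_le_eq)
  moreover have "1 \<le> inverse (pmf \<pi> k)"
    using assms by (intro one_le_inverse) (auto simp: pmf_positive pmf_le_1)
  moreover have "1 \<le> (1 + \<gamma>) powr (real k / 2)" using assms by (intro ge_one_powr_ge_zero) auto
  ultimately have "1 * 1 * 1 \<le> real (n choose k) * inverse (pmf \<pi> k) * (1 + \<gamma>) powr (real k / 2)"
    by (intro mult_mono) auto
  then show ?thesis unfolding map_penalty_def using assms by (intro mult_nonneg_nonneg ln_ge_zero) auto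
qed

text \<open>Minimality of \<open>kh y\<close> is a statement on order statistics; in this form it
  compares index sets and can feed the deterministic loss bound.\<close>

lemma map_selection:
  assumes sel: "map_selector n \<sigma> \<gamma> \<pi> kh" and y: "y \<in> {1..n} \<rightarrow>\<^sub>E UNIV"
    and inj: "inj_on (\<lambda>i. \<bar>y i\<bar>) {1..n}" and S: "S \<subseteq> {1..n}"
  defines "T \<equiv> {i \<in> {1..n}. kh y \<noteq> 0 \<and> abs_order n y (kh y) \<le> \<bar>y i\<bar>}"
  shows "card T = kh y" "kh y \<le> n"
    and "(\<Sum>i\<in>{1..n} - T. (y i)\<^sup>2) + map_penalty n \<sigma> \<gamma> \<pi> (kh y)
      \<le> (\<Sum>i\<in>{1..n} - S. (y i)\<^sup>2) + map_penalty n \<sigma> \<gamma> \<pi> (card S)"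
proof -
  have arg_min: "is_arg_min (map_criterion n \<sigma> \<gamma> \<pi> y) (\<lambda>\<kappa>. \<kappa> \<le> n) (kh y)"
    using sel y by (auto simp: map_selector_def)
  then show kn: "kh y \<le> n" by (simp add: is_arg_min_def)
  have T: "card T = kh y \<and> (\<Sum>i=Suc (kh y)..n. (abs_order n y i)\<^sup>2) = (\<Sum>i\<in>{1..n} - T. (y i)\<^sup>2)"
  proof (cases "kh y = 0")
    \<comment> \<open>By truncated subtraction \<open>abs_order n y 0\<close> reads entry 0 of the
      list and is no threshold for size 0; the guard in \<open>T\<close> makes the set empty
      instead.\<close>
    case True
    obtain ps where ps: "distinct ps" "set ps = {1..n}" "length ps = n"
      "\<And>k. k \<in> {1..n} \<Longrightarrow> abs_order n y k = \<bar>y (ps ! (k - 1))\<bar>"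
      by (rule abs_order_enumeration[of n y]) (rule that, assumption+)
    have "(!) ps ` {0..<n} = {1..n}" unfolding ps(2)[symmetric] set_conv_nth using ps(3) by auto
    then show ?thesis using sum_abs_order_tail[of 0 n ps y] ps True by (simp add: T_def)
  next
    case False
    then show ?thesis
      using abs_order_selection[of "kh y" n y] kn inj by (simp add: T_def)
  qed
  then show "card T = kh y" by simp
  have "card S \<le> n" using card_mono[OF _ S] by simp
  then have "map_criterion n \<sigma> \<gamma> \<pi> y (kh y) \<le> map_criterion n \<sigma> \<gamma> \<pi> y (card S)"
    using arg_min by (auto simp: is_arg_min_linorder)
  then show "(\<Sum>i\<in>{1..n} - T. (y i)\<^sup>2) + map_penalty n \<sigma> \<gamma> \<pi> (kh y)
      \<le> (\<Sum>i\<in>{1..n} - S. (y i)\<^sup>2) + map_penalty n \<sigma> \<gamma> \<pi> (card S)"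
    using sum_abs_order_le[OF S, of y] T by (simp add: map_criterion_def)
qed

lemma ennreal_affine:
  assumes "0 \<le> x" "0 \<le> a" "0 \<le> u" "0 \<le> D" "0 \<le> c" "0 \<le> v"
  shows "ennreal (x * (a * u + D + c * v)) = ennreal x * (ennreal a * ennreal u + ennreal D + ennreal c * ennreal v)"
  using assms by (simp add: ennreal_mult ennreal_plus)

context gaussian_noise
begin

lemma nn_integral_square_z:
  assumes "i \<in> {1..n}"
  shows "(\<integral>\<^sup>+\<omega>. ennreal ((z i \<omega>)\<^sup>2) \<partial>M) = 1"
proof -
  have "(\<integral>\<^sup>+\<omega>. ennreal ((z i \<omega>)\<^sup>2) \<partial>M)
      = (\<integral>\<^sup>+x. ennreal (std_normal_density x) * ennreal (x\<^sup>2) \<partial>lborel)"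
    by (rule distributed_nn_integral[OF normal[OF assms], symmetric]) measurable
  also have "\<dots> = (\<integral>\<^sup>+x. ennreal (std_normal_density x * x ^ (2 * 1)) \<partial>lborel)"
    by (simp add: ennreal_mult')
  also have "\<dots> = 1"
    using integral_std_normal_moment_even[of 1] integrable_std_normal_moment[of 2]
    by (subst nn_integral_eq_integral) auto
  finally show ?thesis .
qed

lemma nn_integral_affine:
  fixes U V :: "'a \<Rightarrow> real"
  assumes [measurable]: "U \<in> borel_measurable M" "V \<in> borel_measurable M"
    and "0 \<le> x" "0 \<le> a" "0 \<le> D" "0 \<le> c" "\<And>\<omega>. 0 \<le> U \<omega>" "\<And>\<omega>. 0 \<le> V \<omega>"
  shows "(\<integral>\<^sup>+\<omega>. ennreal (x * (a * U \<omega> + D + c * V \<omega>)) \<partial>M)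
    = ennreal x * (ennreal a * (\<integral>\<^sup>+\<omega>. ennreal (U \<omega>) \<partial>M) + ennreal D + ennreal c * (\<integral>\<^sup>+\<omega>. ennreal (V \<omega>) \<partial>M))"
  using assms by (simp add: ennreal_affine nn_integral_cmult nn_integral_add emeasure_space_1)

text \<open>The deterministic comparison with \<open>S\<close> is integrated. Replacing the
  dominating variable of the random size by the sum over all sizes removes the selector, and the
  prior weights then add up to \<open>1 - pmf \<pi> 0\<close>.\<close>

lemma risk_oracle_bound:
  assumes \<sigma>: "0 < \<sigma>" and \<gamma>: "0 < \<gamma>" and \<pi>: "set_pmf \<pi> = {0..n}"
    and sel: "map_selector n \<sigma> \<gamma> \<pi> kh"
    and b: "0 < b" "b \<le> 1 / 2" and v: "0 \<le> v"
    and excess: "\<And>k. 1 \<le> k \<Longrightarrow> k \<le> n \<Longrightarrow> excess_le b \<gamma> k (pmf \<pi> k) (pmf \<pi> k + v)"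
    and S: "S \<subseteq> {1..n}"
  shows "risk M z n \<sigma> kh \<mu> \<le> ennreal (1 / b * (\<sigma>\<^sup>2 * real (card S) + map_penalty n \<sigma> \<gamma> \<pi> (card S)
    + (2 + 1 / b) * (\<Sum>i\<in>{1..n} - S. (\<mu> i)\<^sup>2) + 2 * \<sigma>\<^sup>2 * (1 + 1 / \<gamma>) * (1 - pmf \<pi> 0 + real n * v)))"
proof -
  define t where "t = \<gamma> / (2 * (1 + \<gamma>))"
  define a where "a = 2 * \<sigma>\<^sup>2 * (1 + 1 / \<gamma>)"
  define W where "W k = ln (real (n choose k) * inverse (pmf \<pi> k) * (1 + \<gamma>) powr (real k / 2))" for k
  \<comment> \<open>The identity \<open>a t = \<sigma>^2\<close> is the calibration that puts noise
    energy and penalty in the same unit.\<close>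
  have a: "0 < a" "a * t = \<sigma>\<^sup>2" using \<sigma> \<gamma> by (auto simp: a_def t_def divide_simps)
  have pen: "map_penalty n \<sigma> \<gamma> \<pi> k = a * W k" for k by (simp add: map_penalty_def a_def W_def)
  have pen_nonneg: "0 \<le> map_penalty n \<sigma> \<gamma> \<pi> k" if "k \<le> n" for k
    using map_penalty_nonneg[OF \<gamma> that] \<pi> that by auto
  have "\<forall>k\<in>{1..n}. \<exists>B. B \<in> borel_measurable M \<and> (\<forall>\<omega>. 0 \<le> B \<omega>) \<and>
    (\<forall>\<omega> J. J \<subseteq> {1..n} \<longrightarrow> card J = k \<longrightarrow> (1 + 2 * b) * t * (\<Sum>i\<in>J. (z i \<omega>)\<^sup>2) - W k \<le> B \<omega>) \<and>
    (\<integral>\<^sup>+\<omega>. ennreal (B \<omega>) \<partial>M) \<le> ennreal (pmf \<pi> k + v)"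
  proof
    fix k assume "k \<in> {1..n}"
    then have "excess_le b \<gamma> k (pmf \<pi> k) (pmf \<pi> k + v)" using excess by simp
    then show "\<exists>B. B \<in> borel_measurable M \<and> (\<forall>\<omega>. 0 \<le> B \<omega>) \<and>
      (\<forall>\<omega> J. J \<subseteq> {1..n} \<longrightarrow> card J = k \<longrightarrow> (1 + 2 * b) * t * (\<Sum>i\<in>J. (z i \<omega>)\<^sup>2) - W k \<le> B \<omega>) \<and>
      (\<integral>\<^sup>+\<omega>. ennreal (B \<omega>) \<partial>M) \<le> ennreal (pmf \<pi> k + v)"
      unfolding excess_le_def t_def W_def Bex_def .
  qed
  from bchoice[OF this] obtain B where B: "\<And>k. k \<in> {1..n} \<Longrightarrow> B k \<in> borel_measurable M"
    "\<And>k \<omega>. k \<in> {1..n} \<Longrightarrow> 0 \<le> B k \<omega>"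
    "\<And>k \<omega> J. k \<in> {1..n} \<Longrightarrow> J \<subseteq> {1..n} \<Longrightarrow> card J = k \<Longrightarrow>
      (1 + 2 * b) * t * (\<Sum>i\<in>J. (z i \<omega>)\<^sup>2) - W k \<le> B k \<omega>"
    "\<And>k. k \<in> {1..n} \<Longrightarrow> (\<integral>\<^sup>+\<omega>. ennreal (B k \<omega>) \<partial>M) \<le> ennreal (pmf \<pi> k + v)"
    by blast
  define D where "D = map_penalty n \<sigma> \<gamma> \<pi> (card S) + (2 + 1 / b) * (\<Sum>i\<in>{1..n} - S. (\<mu> i)\<^sup>2)"
  have "card S \<le> n" using card_mono[OF _ S] by simp
  then have D: "0 \<le> D" using pen_nonneg b by (auto simp: D_def intro!: add_nonneg_nonneg mult_nonneg_nonneg sum_nonneg)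
  have pw: "AE \<omega> in M. (\<Sum>i=1..n. (map_estimator n kh (observation n \<sigma> z \<mu> \<omega>) i - \<mu> i)\<^sup>2)
      \<le> 1 / b * (\<sigma>\<^sup>2 * (\<Sum>i\<in>S. (z i \<omega>)\<^sup>2) + D + a * (\<Sum>k=1..n. B k \<omega>))"
    using AE_no_ties[OF less_imp_neq[OF \<sigma>, symmetric], of \<mu>]
  proof (rule eventually_mono)
    fix \<omega> assume inj: "inj_on (\<lambda>i. \<bar>\<mu> i + \<sigma> * z i \<omega>\<bar>) {1..n}"
    define y where "y = observation n \<sigma> z \<mu> \<omega>"
    define T where "T = {i \<in> {1..n}. kh y \<noteq> 0 \<and> abs_order n y (kh y) \<le> \<bar>y i\<bar>}"
    have yi: "y i = \<mu> i + \<sigma> * z i \<omega>" if "i \<in> {1..n}" for i using that by (simp add: y_def observation_def)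
    have yE: "y \<in> {1..n} \<rightarrow>\<^sub>E UNIV" by (simp add: y_def observation_def)
    have "inj_on (\<lambda>i. \<bar>y i\<bar>) {1..n} \<longleftrightarrow> inj_on (\<lambda>i. \<bar>\<mu> i + \<sigma> * z i \<omega>\<bar>) {1..n}"
      using yi by (intro inj_on_cong) simp
    with inj have inj': "inj_on (\<lambda>i. \<bar>y i\<bar>) {1..n}" by blast
    note T = map_selection[OF sel yE inj' S, folded T_def]
    have sub: "T \<subseteq> {1..n}" by (auto simp: T_def)
    have loss: "(\<Sum>i=1..n. (map_estimator n kh y i - \<mu> i)\<^sup>2)
        = (\<Sum>i\<in>T. (\<sigma> * z i \<omega>)\<^sup>2) + (\<Sum>i\<in>{1..n} - T. (\<mu> i)\<^sup>2)"
    proof -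
      have "(\<Sum>i=1..n. (map_estimator n kh y i - \<mu> i)\<^sup>2)
          = (\<Sum>i\<in>{1..n} - T. (map_estimator n kh y i - \<mu> i)\<^sup>2) + (\<Sum>i\<in>T. (map_estimator n kh y i - \<mu> i)\<^sup>2)"
        by (rule sum.subset_diff[OF sub]) simp
      also have "(\<Sum>i\<in>T. (map_estimator n kh y i - \<mu> i)\<^sup>2) = (\<Sum>i\<in>T. (\<sigma> * z i \<omega>)\<^sup>2)"
        by (intro sum.cong) (auto simp: T_def map_estimator_def yi)
      also have "(\<Sum>i\<in>{1..n} - T. (map_estimator n kh y i - \<mu> i)\<^sup>2) = (\<Sum>i\<in>{1..n} - T. (\<mu> i)\<^sup>2)"
        by (intro sum.cong) (auto simp: T_def map_estimator_def)
      finally show ?thesis by simp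
    qed
    have scale: "(\<Sum>i\<in>A. (\<sigma> * z i \<omega>)\<^sup>2) = \<sigma>\<^sup>2 * (\<Sum>i\<in>A. (z i \<omega>)\<^sup>2)" for A
      by (simp add: power_mult_distrib sum_distrib_left)
    have "(1 + 2 * b) * (\<Sum>i\<in>T. (\<sigma> * z i \<omega>)\<^sup>2) - map_penalty n \<sigma> \<gamma> \<pi> (kh y) \<le> a * (\<Sum>k=1..n. B k \<omega>)"
    proof (cases "kh y = 0")
      case True
      then have "T = {}" by (simp add: T_def)
      moreover have "0 \<le> a * (\<Sum>k=1..n. B k \<omega>)" using a B(2) by (intro mult_nonneg_nonneg sum_nonneg) auto
      ultimately show ?thesis using pen_nonneg[OF T(2)] by simp
    next
      case False
      then have k: "kh y \<in> {1..n}" using T(2) by simp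
      have "(1 + 2 * b) * (\<Sum>i\<in>T. (\<sigma> * z i \<omega>)\<^sup>2) - map_penalty n \<sigma> \<gamma> \<pi> (kh y)
          = a * ((1 + 2 * b) * t * (\<Sum>i\<in>T. (z i \<omega>)\<^sup>2) - W (kh y))"
        unfolding scale pen a(2)[symmetric] by (simp add: algebra_simps)
      also have "\<dots> \<le> a * B (kh y) \<omega>" using a B(3)[OF k sub T(1)] by (intro mult_left_mono) auto
      also have "\<dots> \<le> a * (\<Sum>k=1..n. B k \<omega>)"
        using a B(2) k by (intro mult_left_mono member_le_sum) auto
      finally show ?thesis .
    qed
    moreover note selection_loss_bound[OF finite_atLeastAtMost sub S b yi T(3)]
    ultimately have "b * (\<Sum>i=1..n. (map_estimator n kh y i - \<mu> i)\<^sup>2)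
        \<le> \<sigma>\<^sup>2 * (\<Sum>i\<in>S. (z i \<omega>)\<^sup>2) + D + a * (\<Sum>k=1..n. B k \<omega>)"
      unfolding loss by (simp add: scale D_def)
    then show "(\<Sum>i=1..n. (map_estimator n kh (observation n \<sigma> z \<mu> \<omega>) i - \<mu> i)\<^sup>2)
      \<le> 1 / b * (\<sigma>\<^sup>2 * (\<Sum>i\<in>S. (z i \<omega>)\<^sup>2) + D + a * (\<Sum>k=1..n. B k \<omega>))"
      using b by (simp add: y_def field_simps)
  qed
  have B_meas: "(\<lambda>\<omega>. \<Sum>k=1..n. B k \<omega>) \<in> borel_measurable M"
    using B(1) by (intro borel_measurable_sum) auto
  have z_meas: "z i \<in> borel_measurable M" if "i \<in> S" for i using measurable_z S that by blast
  have S_meas: "(\<lambda>\<omega>. \<Sum>i\<in>S. (z i \<omega>)\<^sup>2) \<in> borel_measurable M"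
    using z_meas by (intro borel_measurable_sum borel_measurable_power) auto
  have finS: "finite S" using S finite_subset by blast
  have intS: "(\<integral>\<^sup>+\<omega>. ennreal (\<Sum>i\<in>S. (z i \<omega>)\<^sup>2) \<partial>M) = ennreal (real (card S))"
  proof -
    have "(\<integral>\<^sup>+\<omega>. ennreal (\<Sum>i\<in>S. (z i \<omega>)\<^sup>2) \<partial>M) = (\<integral>\<^sup>+\<omega>. (\<Sum>i\<in>S. ennreal ((z i \<omega>)\<^sup>2)) \<partial>M)"
      by (simp add: sum_ennreal)
    also have "\<dots> = (\<Sum>i\<in>S. \<integral>\<^sup>+\<omega>. ennreal ((z i \<omega>)\<^sup>2) \<partial>M)"
      using z_meas by (intro nn_integral_sum measurable_compose[OF borel_measurable_power measurable_ennreal]) auto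
    also have "\<dots> = (\<Sum>i\<in>S. 1)" using nn_integral_square_z S by (intro sum.cong) auto
    finally show ?thesis by (simp add: ennreal_of_nat_eq_real_of_nat)
  qed
  have intB: "(\<integral>\<^sup>+\<omega>. ennreal (\<Sum>k=1..n. B k \<omega>) \<partial>M) \<le> ennreal (1 - pmf \<pi> 0 + real n * v)"
  proof -
    have "(\<integral>\<^sup>+\<omega>. ennreal (\<Sum>k=1..n. B k \<omega>) \<partial>M) = (\<integral>\<^sup>+\<omega>. (\<Sum>k=1..n. ennreal (B k \<omega>)) \<partial>M)"
      by (intro nn_integral_cong sum_ennreal[symmetric] B(2))
    also have "\<dots> = (\<Sum>k=1..n. \<integral>\<^sup>+\<omega>. ennreal (B k \<omega>) \<partial>M)"
      using B(1) by (intro nn_integral_sum) auto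
    also have "\<dots> \<le> (\<Sum>k=1..n. ennreal (pmf \<pi> k + v))" by (intro sum_mono B) auto
    also have "\<dots> = ennreal (\<Sum>k=1..n. pmf \<pi> k + v)" using v by (intro sum_ennreal) auto
    also have "(\<Sum>k=1..n. pmf \<pi> k + v) = (\<Sum>k=1..n. pmf \<pi> k) + real n * v" by (simp add: sum.distrib)
    also have "(\<Sum>k=1..n. pmf \<pi> k) = 1 - pmf \<pi> 0"
    proof -
      have "(\<Sum>k=0..n. pmf \<pi> k) = 1" using \<pi> by (intro sum_pmf_eq_1) auto
      then show ?thesis by (simp add: sum.atLeast_Suc_atMost)
    qed
    finally show ?thesis .
  qed
  have "risk M z n \<sigma> kh \<mu>
      \<le> (\<integral>\<^sup>+\<omega>. ennreal (1 / b * (\<sigma>\<^sup>2 * (\<Sum>i\<in>S. (z i \<omega>)\<^sup>2) + D + a * (\<Sum>k=1..n. B k \<omega>))) \<partial>M)"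
    \<comment> \<open>The loss may fail to be measurable through \<open>kh\<close>; monotonicity of
      the integral under an almost sure inequality still applies, since the upper bound is the
      integrand to be computed.\<close>
    unfolding risk_def using pw by (intro nn_integral_mono_AE) (auto elim!: eventually_mono intro: ennreal_leI)
  also have "\<dots> = ennreal (1 / b) * (ennreal (\<sigma>\<^sup>2) * (\<integral>\<^sup>+\<omega>. ennreal (\<Sum>i\<in>S. (z i \<omega>)\<^sup>2) \<partial>M) + ennreal D
      + ennreal a * (\<integral>\<^sup>+\<omega>. ennreal (\<Sum>k=1..n. B k \<omega>) \<partial>M))"
    using b a D B(2) by (intro nn_integral_affine S_meas B_meas) (auto intro!: sum_nonneg)
  also have "\<dots> \<le> ennreal (1 / b) * (ennreal (\<sigma>\<^sup>2) * ennreal (real (card S)) + ennreal D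
      + ennreal a * ennreal (1 - pmf \<pi> 0 + real n * v))"
    unfolding intS by (intro mult_left_mono add_left_mono intB) auto
  also have "\<dots> = ennreal (1 / b * (\<sigma>\<^sup>2 * real (card S) + D + a * (1 - pmf \<pi> 0 + real n * v)))"
    using b a D v by (subst ennreal_affine) (auto simp: pmf_le_1)
  finally show ?thesis by (simp add: D_def a_def add.assoc)
qed

end

section \<open>Rates over balls\<close>

lemma ennreal_in_class_bigoI:
  assumes le: "\<forall>\<^sub>F n in sequentially. f n \<le> ennreal (C * g n)"
    and nonneg: "\<forall>\<^sub>F n in sequentially. 0 \<le> C * g n"
  shows "ennreal_in_class f (O(g))"
  unfolding ennreal_in_class_def
proof (intro bexI[of _ "\<lambda>n. enn2real (f n)"])
  show "\<forall>\<^sub>F n in sequentially. f n = ennreal (enn2real (f n))"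
    using le by eventually_elim (metis ennreal_enn2real ennreal_less_top le_less_trans)
  show "(\<lambda>n. enn2real (f n)) \<in> O(g)"
  proof (rule bigoI)
    show "\<forall>\<^sub>F n in sequentially. norm (enn2real (f n)) \<le> \<bar>C\<bar> * norm (g n)"
      using le nonneg
    proof eventually_elim
      case (elim n)
      then have "enn2real (f n) \<le> C * g n" by (intro enn2real_leI) auto
      also have "\<dots> \<le> \<bar>C\<bar> * norm (g n)" by (simp add: abs_mult[symmetric])
      finally show ?case by simp
    qed
  qed
qed

lemma ennreal_in_class_bigo_sumI:
  assumes le: "\<forall>\<^sub>F n in sequentially. F n \<le> ennreal (C * f n + D * g n)"
    and nonneg: "\<forall>\<^sub>F n in sequentially. 0 \<le> C * f n" "\<forall>\<^sub>F n in sequentially. 0 \<le> D * g n"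
  shows "ennreal_in_class F (bigo_sum f g)"
proof -
  \<comment> \<open>Capping \<open>F\<close> at \<open>C f\<close> gives the first summand; the rest
    is at most \<open>D g\<close>, because \<open>F\<close> is at most the sum of the two.\<close>
  define u where "u n = min (enn2real (F n)) (C * f n)" for n
  define v where "v n = enn2real (F n) - u n" for n
  have u: "u \<in> O(f)"
  proof (rule bigoI)
    show "\<forall>\<^sub>F n in sequentially. norm (u n) \<le> \<bar>C\<bar> * norm (f n)"
      using nonneg(1) by eventually_elim (auto simp: u_def abs_mult[symmetric] min_def)
  qed
  have v: "v \<in> O(g)"
  proof (rule bigoI)
    show "\<forall>\<^sub>F n in sequentially. norm (v n) \<le> \<bar>D\<bar> * norm (g n)"
      using le nonneg
    proof eventually_elim
      case (elim n)
      then have "enn2real (F n) \<le> C * f n + D * g n" by (intro enn2real_leI) auto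
      then show ?case using elim by (auto simp: v_def u_def abs_mult[symmetric] min_def)
    qed
  qed
  show ?thesis unfolding ennreal_in_class_def
  proof (intro bexI[of _ "\<lambda>n. u n + v n"])
    show "\<forall>\<^sub>F n in sequentially. F n = ennreal (u n + v n)"
      using le by eventually_elim (simp add: v_def, metis ennreal_enn2real ennreal_less_top le_less_trans)
    show "(\<lambda>n. u n + v n) \<in> bigo_sum f g" using u v by (auto simp: bigo_sum_def)
  qed
qed

section \<open>Energy of vectors in balls\<close>

lemma lp_ball_sum_powr_le:
  assumes "0 < p" "0 < \<sigma>" "0 < \<eta>" "1 \<le> n" and \<mu>: "\<mu> \<in> lp_ball n (ennreal p) \<sigma> \<eta>"
  shows "(\<Sum>i=1..n. \<bar>\<mu> i\<bar> powr p) \<le> real n * (\<sigma> * \<eta>) powr p"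
proof -
  define X where "X = (\<Sum>i=1..n. \<bar>\<mu> i\<bar> powr p)"
  have X: "0 \<le> X" by (simp add: X_def sum_nonneg)
  have "X powr (1 / p) \<le> real n powr (1 / p) * \<sigma> * \<eta>"
    using \<mu> assms(1) by (simp add: lp_ball_def lp_norm_def X_def)
  then have "(X powr (1 / p)) powr p \<le> (real n powr (1 / p) * (\<sigma> * \<eta>)) powr p"
    using assms by (intro powr_mono2) (auto simp: mult.assoc)
  also have "\<dots> = real n * (\<sigma> * \<eta>) powr p"
    using assms by (simp add: powr_mult powr_powr)
  finally have "X \<le> real n * (\<sigma> * \<eta>) powr p" using assms X by (simp add: powr_powr)
  then show ?thesis by (simp only: X_def)
qed

text \<open>For finite exponents a pointwise bound replaces Hoelder's inequality: up to
  \<open>D\<close> a square is at most \<open>D^2\<close>, and beyond \<open>D\<close> the ratio to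
  \<open>D\<close> exceeds 1, so its square is at most its \<open>q\<close>-th power. The price is
  the factor 2.\<close>

lemma lp_ball_sum_squares_le_of_ge_2:
  assumes "2 \<le> p" "0 < \<sigma>" "0 < \<eta>" "1 \<le> n" and \<mu>: "\<mu> \<in> lp_ball n p \<sigma> \<eta>"
  shows "(\<Sum>i=1..n. (\<mu> i)\<^sup>2) \<le> 2 * (\<sigma>\<^sup>2 * real n * \<eta>\<^sup>2)"
proof -
  define D where "D = \<sigma> * \<eta>"
  have D: "0 < D" using assms by (simp add: D_def)
  have "(\<Sum>i=1..n. (\<mu> i)\<^sup>2) \<le> 2 * (real n * D\<^sup>2)"
  proof (cases "p = \<infinity>")
    case True
    have "(MAX i\<in>{1..n}. \<bar>\<mu> i\<bar>) \<le> D" using \<mu> True by (simp add: lp_ball_def lp_norm_def D_def)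
    then have "\<bar>\<mu> i\<bar> \<le> D" if "i \<in> {1..n}" for i
      using that assms(4) by (subst (asm) Max_le_iff) auto
    then have "(\<mu> i)\<^sup>2 \<le> D\<^sup>2" if "i \<in> {1..n}" for i
      using that D by (metis abs_le_square_iff abs_of_pos)
    then have "(\<Sum>i=1..n. (\<mu> i)\<^sup>2) \<le> (\<Sum>i=1..n. D\<^sup>2)" by (intro sum_mono) auto
    then show ?thesis by (simp add: D_def) (smt (verit) mult_nonneg_nonneg of_nat_0_le_iff zero_le_power2)
  next
    case False
    then obtain q where q: "p = ennreal q" "0 \<le> q" by (cases p) auto
    then have "2 \<le> q" using assms(1) by (metis ennreal_le_iff ennreal_numeral)
    have sum_le: "(\<Sum>i=1..n. \<bar>\<mu> i\<bar> powr q) \<le> real n * D powr q"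
      unfolding D_def using assms q \<open>2 \<le> q\<close> by (intro lp_ball_sum_powr_le) auto
    have "(\<mu> i)\<^sup>2 \<le> D\<^sup>2 + D\<^sup>2 / D powr q * \<bar>\<mu> i\<bar> powr q" for i
    proof (cases "\<bar>\<mu> i\<bar> \<le> D")
      case True
      then have "(\<mu> i)\<^sup>2 \<le> D\<^sup>2" using D by (metis abs_le_square_iff abs_of_pos)
      moreover have "0 \<le> D\<^sup>2 / D powr q * \<bar>\<mu> i\<bar> powr q" by simp
      ultimately show ?thesis by linarith
    next
      case False
      define x where "x = \<bar>\<mu> i\<bar> / D"
      have x: "1 \<le> x" "0 < \<bar>\<mu> i\<bar>" using False D by (auto simp: x_def)
      have "(\<mu> i)\<^sup>2 = D\<^sup>2 * x powr 2" using D x by (simp add: x_def power_divide)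
      also have "\<dots> \<le> D\<^sup>2 * x powr q" using x \<open>2 \<le> q\<close> by (intro mult_left_mono powr_mono) auto
      also have "\<dots> = D\<^sup>2 / D powr q * \<bar>\<mu> i\<bar> powr q" using D by (simp add: x_def powr_divide)
      finally show ?thesis by (simp add: add_increasing)
    qed
    then have "(\<Sum>i=1..n. (\<mu> i)\<^sup>2) \<le> (\<Sum>i=1..n. D\<^sup>2 + D\<^sup>2 / D powr q * \<bar>\<mu> i\<bar> powr q)"
      by (intro sum_mono) auto
    also have "\<dots> = real n * D\<^sup>2 + D\<^sup>2 / D powr q * (\<Sum>i=1..n. \<bar>\<mu> i\<bar> powr q)"
      by (simp add: sum.distrib sum_distrib_left)
    also have "\<dots> \<le> real n * D\<^sup>2 + D\<^sup>2 / D powr q * (real n * D powr q)"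
      using sum_le by (intro add_left_mono mult_left_mono) auto
    also have "\<dots> = 2 * (real n * D\<^sup>2)" using D by simp
    finally show ?thesis .
  qed
  then show ?thesis by (simp add: D_def power_mult_distrib mult_ac)
qed

lemma sum_squares_le_powr:
  fixes x :: "'i \<Rightarrow> real"
  assumes "p < 2" "0 \<le> c" and "\<And>i. i \<in> A \<Longrightarrow> \<bar>x i\<bar> \<le> c"
  shows "(\<Sum>i\<in>A. (x i)\<^sup>2) \<le> c powr (2 - p) * (\<Sum>i\<in>A. \<bar>x i\<bar> powr p)"
proof -
  have "(x i)\<^sup>2 \<le> c powr (2 - p) * \<bar>x i\<bar> powr p" if "i \<in> A" for i
  proof (cases "x i = 0")
    case False
    then have "(x i)\<^sup>2 = \<bar>x i\<bar> powr (2 - p) * \<bar>x i\<bar> powr p" by (simp add: powr_add[symmetric])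
    also have "\<dots> \<le> c powr (2 - p) * \<bar>x i\<bar> powr p"
      using assms that by (intro mult_right_mono powr_mono2) auto
    finally show ?thesis .
  qed auto
  then show ?thesis by (simp add: sum_distrib_left sum_mono)
qed

text \<open>No coordinate exceeds the unnormalized radius \<open>c\<close>. Hence
  \<open>c^(2 - p)\<close> can be taken out of each square, and the remaining \<open>p\<close>-th
  powers sum to at most \<open>c^p\<close>.\<close>

lemma lp_ball_sum_squares_le_of_less_2:
  assumes "0 < p" "p < 2" "0 < \<sigma>" "0 < \<eta>" "1 \<le> n" and \<mu>: "\<mu> \<in> lp_ball n (ennreal p) \<sigma> \<eta>"
  shows "(\<Sum>i=1..n. (\<mu> i)\<^sup>2) \<le> \<sigma>\<^sup>2 * real n powr (2 / p) * \<eta>\<^sup>2"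
proof -
  define c where "c = real n powr (1 / p) * (\<sigma> * \<eta>)"
  have c: "0 < c" "c powr p = real n * (\<sigma> * \<eta>) powr p"
    using assms by (auto simp: c_def powr_mult powr_powr)
  have sum_le: "(\<Sum>i=1..n. \<bar>\<mu> i\<bar> powr p) \<le> c powr p"
    unfolding c(2) using assms by (intro lp_ball_sum_powr_le) auto
  have "\<bar>\<mu> i\<bar> \<le> c" if "i \<in> {1..n}" for i
  proof -
    have "\<bar>\<mu> i\<bar> powr p \<le> (\<Sum>i=1..n. \<bar>\<mu> i\<bar> powr p)" using that by (intro member_le_sum) auto
    then have "\<bar>\<mu> i\<bar> powr p \<le> c powr p" using sum_le by simp
    then show ?thesis using powr_less_mono2[of p c "\<bar>\<mu> i\<bar>"] assms(1) c by linarith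
  qed
  then have "(\<Sum>i=1..n. (\<mu> i)\<^sup>2) \<le> c powr (2 - p) * (\<Sum>i=1..n. \<bar>\<mu> i\<bar> powr p)"
    using assms c by (intro sum_squares_le_powr) auto
  also have "\<dots> \<le> c powr (2 - p) * c powr p" using sum_le by (intro mult_left_mono) auto
  also have "\<dots> = c\<^sup>2" using c(1) by (simp add: powr_add[symmetric])
  also have "\<dots> = \<sigma>\<^sup>2 * real n powr (2 / p) * \<eta>\<^sup>2"
    using assms by (simp add: c_def power_mult_distrib powr_power)
  finally show ?thesis .
qed

text \<open>
  \<open>S\<close> consists of the coordinates above the threshold \<open>\<sigma> L\<^sup>1\<^sup>/\<^sup>2\<close>, padded to size exactly
  \<open>k\<close>: the prior is bounded below at one prescribed size only, and not at \<open>0\<close>.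
\<close>

lemma lp_ball_sparse_approximation:
  assumes "0 < p" "p < 2" "0 < \<sigma>" "0 < \<eta>" "1 \<le> n" "0 < L"
    and \<mu>: "\<mu> \<in> lp_ball n (ennreal p) \<sigma> \<eta>"
    and k: "real n * \<eta> powr p / L powr (p / 2) < real k + 1" "k \<le> n"
  obtains S where "S \<subseteq> {1..n}" "card S = k"
    "(\<Sum>i\<in>{1..n} - S. (\<mu> i)\<^sup>2) \<le> \<sigma>\<^sup>2 * real n * \<eta> powr p * L powr (1 - p / 2)"
proof -
  define c where "c = \<sigma> * sqrt L"
  define N where "N = {i \<in> {1..n}. c < \<bar>\<mu> i\<bar>}"
  have c: "0 < c" "c powr p = \<sigma> powr p * L powr (p / 2)"
    using assms by (auto simp: c_def powr_mult powr_half_sqrt[symmetric] powr_powr)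
  have sum_le: "(\<Sum>i=1..n. \<bar>\<mu> i\<bar> powr p) \<le> real n * (\<sigma> * \<eta>) powr p"
    using assms by (intro lp_ball_sum_powr_le) auto
  \<comment> \<open>Markov's inequality for the counting measure limits the number of coordinates
    above the threshold.\<close>
  have "real (card N) * c powr p = (\<Sum>i\<in>N. c powr p)" by simp
  also have "\<dots> \<le> (\<Sum>i\<in>N. \<bar>\<mu> i\<bar> powr p)"
    using c assms by (intro sum_mono powr_mono2) (auto simp: N_def)
  also have "\<dots> \<le> (\<Sum>i=1..n. \<bar>\<mu> i\<bar> powr p)" by (intro sum_mono2) (auto simp: N_def)
  finally have "real (card N) * c powr p \<le> real n * (\<sigma> * \<eta>) powr p" using sum_le by linarith
  then have "real (card N) \<le> real n * \<eta> powr p / L powr (p / 2)"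
    using assms by (simp add: c powr_mult field_simps)
  then have "card N \<le> k" using k by linarith
  have "N \<subseteq> {1..n}" by (auto simp: N_def)
  with \<open>card N \<le> k\<close> obtain S where S: "N \<subseteq> S" "S \<subseteq> {1..n}" "card S = k"
    using exists_subset_between[of N k "{1..n}"] k by auto
  have "\<bar>\<mu> i\<bar> \<le> c" if "i \<in> {1..n} - S" for i
  proof (rule ccontr)
    assume "\<not> \<bar>\<mu> i\<bar> \<le> c"
    then have "i \<in> N" using that by (simp add: N_def)
    then show False using that S(1) by blast
  qed
  then have "(\<Sum>i\<in>{1..n} - S. (\<mu> i)\<^sup>2) \<le> c powr (2 - p) * (\<Sum>i\<in>{1..n} - S. \<bar>\<mu> i\<bar> powr p)"
    using assms(2) c(1) by (intro sum_squares_le_powr) auto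
  also have "\<dots> \<le> c powr (2 - p) * (\<Sum>i=1..n. \<bar>\<mu> i\<bar> powr p)"
    by (intro mult_left_mono sum_mono2) auto
  also have "\<dots> \<le> c powr (2 - p) * (real n * (\<sigma> * \<eta>) powr p)"
    using sum_le by (intro mult_left_mono) auto
  also have "\<dots> = \<sigma>\<^sup>2 * real n * \<eta> powr p * L powr (1 - p / 2)"
  proof -
    have "c powr (2 - p) = \<sigma> powr (2 - p) * L powr ((2 - p) / 2)"
      using assms by (simp add: c_def powr_mult powr_half_sqrt[symmetric] powr_powr)
    moreover have "(2 - p) / 2 = 1 - p / 2" by (simp add: diff_divide_distrib)
    moreover have "\<sigma> powr (2 - p) * \<sigma> powr p = \<sigma>\<^sup>2" using assms by (simp add: powr_add[symmetric])
    moreover have "(\<sigma> * \<eta>) powr p = \<sigma> powr p * \<eta> powr p" using assms by (simp add: powr_mult)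
    moreover have "c powr (2 - p) * (real n * (\<sigma> * \<eta>) powr p)
        = (\<sigma> powr (2 - p) * \<sigma> powr p) * real n * \<eta> powr p * L powr (1 - p / 2)"
      if "c powr (2 - p) = \<sigma> powr (2 - p) * L powr (1 - p / 2)" "(\<sigma> * \<eta>) powr p = \<sigma> powr p * \<eta> powr p"
      unfolding that by (simp only: mult_ac)
    ultimately show ?thesis by simp
  qed
  finally show thesis by (rule that[OF S(2,3)])
qed

lemma map_penalty_le:
  assumes "0 < lo" "lo \<le> \<gamma>" "\<gamma> \<le> hi" "k \<le> n" "k \<in> set_pmf \<pi>"
  shows "map_penalty n \<sigma> \<gamma> \<pi> k
    \<le> 2 * \<sigma>\<^sup>2 * (1 + 1 / lo) * (ln (real (n choose k)) - ln (pmf \<pi> k) + real k * ln (1 + hi))"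
proof -
  have C: "0 < real (n choose k)" "0 < pmf \<pi> k" using assms by (auto simp: pmf_positive)
  define W where "W = ln (real (n choose k) * inverse (pmf \<pi> k) * (1 + \<gamma>) powr (real k / 2))"
  have pen: "map_penalty n \<sigma> \<gamma> \<pi> k = 2 * \<sigma>\<^sup>2 * (1 + 1 / \<gamma>) * W" by (simp add: map_penalty_def W_def)
  have "W = ln (real (n choose k)) - ln (pmf \<pi> k) + real k / 2 * ln (1 + \<gamma>)"
    using C assms by (simp add: W_def ln_mult ln_inverse ln_powr)
  moreover have "real k / 2 * ln (1 + \<gamma>) \<le> real k * ln (1 + hi)"
    using assms by (intro mult_mono ln_mono) auto
  ultimately have W: "W \<le> ln (real (n choose k)) - ln (pmf \<pi> k) + real k * ln (1 + hi)" by linarith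
  \<comment> \<open>The prefactor can be enlarged from \<open>1 + 1 / \<gamma>\<close> to
    \<open>1 + 1 / lo\<close> once \<open>W\<close> is known to be nonnegative.\<close>
  have "1 * 1 \<le> real (n choose k) * inverse (pmf \<pi> k)"
    using C assms by (intro mult_mono one_le_inverse) (auto simp: Suc_le_eq pmf_le_1)
  moreover have "1 \<le> (1 + \<gamma>) powr (real k / 2)" using assms by (intro ge_one_powr_ge_zero) auto
  ultimately have "1 * 1 \<le> real (n choose k) * inverse (pmf \<pi> k) * (1 + \<gamma>) powr (real k / 2)"
    by (intro mult_mono) auto
  then have "0 \<le> W" unfolding W_def by (intro ln_ge_zero) simp
  then have "2 * \<sigma>\<^sup>2 * (1 + 1 / \<gamma>) * W \<le> 2 * \<sigma>\<^sup>2 * (1 + 1 / lo) * W"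
    using assms by (intro mult_right_mono mult_left_mono add_left_mono divide_left_mono) auto
  also have "\<dots> \<le> 2 * \<sigma>\<^sup>2 * (1 + 1 / lo) * (ln (real (n choose k)) - ln (pmf \<pi> k) + real k * ln (1 + hi))"
    using W assms by (intro mult_left_mono) auto
  finally show ?thesis unfolding pen .
qed

theorem proposition1:
  fixes M :: "nat \<Rightarrow> 'a measure"
    and z :: "nat \<Rightarrow> nat \<Rightarrow> 'a \<Rightarrow> real"
    and \<sigma> \<tau> \<gamma> \<eta> :: "nat \<Rightarrow> real"
    and \<pi> :: "nat \<Rightarrow> nat pmf"
    and kh :: "nat \<Rightarrow> (nat \<Rightarrow> real) \<Rightarrow> nat"
    and \<gamma>_lo \<gamma>_hi :: real
  assumes "\<And>n. n \<ge> 1 \<Longrightarrow> prob_space (M n)"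
    and "\<And>n. n \<ge> 1 \<Longrightarrow> prob_space.indep_vars (M n) (\<lambda>_. borel) (z n) {1..n}"
    and "\<And>n i. n \<ge> 1 \<Longrightarrow> i \<in> {1..n} \<Longrightarrow>
           distributed (M n) lborel (z n i) (\<lambda>x. ennreal (std_normal_density x))"
    and "\<And>n. n \<ge> 1 \<Longrightarrow> \<sigma> n > 0"
    and "\<And>n. n \<ge> 1 \<Longrightarrow> \<tau> n > 0"
    and "\<And>n. n \<ge> 1 \<Longrightarrow> \<eta> n > 0"
    and "\<And>n. n \<ge> 1 \<Longrightarrow> \<gamma> n = (\<tau> n)\<^sup>2 / (\<sigma> n)\<^sup>2"
    and "\<And>n. n \<ge> 1 \<Longrightarrow> set_pmf (\<pi> n) = {0..n}"
    and "\<And>n. n \<ge> 1 \<Longrightarrow> map_selector n (\<sigma> n) (\<gamma> n) (\<pi> n) (kh n)"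
    and "\<gamma>_lo > 0" and "\<gamma>_hi > 0"
    and "\<And>n. n \<ge> 1 \<Longrightarrow> \<gamma>_lo \<le> \<gamma> n \<and> \<gamma> n \<le> \<gamma>_hi"
  defines "R \<equiv> \<lambda>p n. max_risk (M n) (z n) n (\<sigma> n) (kh n) (lp_ball n p (\<sigma> n) (\<eta> n))"
  shows
    "(\<forall>(p::ennreal) (c0::real).
        0 < p \<and> c0 > 0 \<and>
        (\<forall>\<^sub>F n in sequentially. pmf (\<pi> n) n \<ge> exp (- c0 * real n))
        \<longrightarrow> ennreal_in_class (R p) (O(\<lambda>n. real n * (\<sigma> n)\<^sup>2)))
   \<and> (\<forall>(p::ennreal) (\<beta>::real) (c1::real).
        2 \<le> p \<and> \<beta> \<ge> 0 \<and> c1 > 0 \<and>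
        (\<forall>\<^sub>F n in sequentially. pmf (\<pi> n) 0 \<ge> real n powr (- c1 * real n powr (- \<beta>)))
        \<longrightarrow> ennreal_in_class (R p)
              (bigo_sum (\<lambda>n. (\<sigma> n)\<^sup>2 * real n * (\<eta> n)\<^sup>2)
                        (\<lambda>n. (\<sigma> n)\<^sup>2 * real n powr (- \<beta>) * ln (real n))))
   \<and> (\<forall>(p::real) (\<alpha>::nat \<Rightarrow> real) (c2::real).
        0 < p \<and> p < 2 \<and> c2 > 0 \<and>
        (\<forall>\<^sub>F n in sequentially.
           (2 * ln (real n)) powr (p / 2) / real n \<le> \<alpha> n \<and>
           \<alpha> n \<le> exp (- (8 * (\<gamma> n + 3 / 4)\<^sup>2))) \<and>
        (\<forall>\<^sub>F n in sequentially. \<forall>\<kappa>::nat. 1 \<le> \<kappa> \<and> real \<kappa> \<le> \<alpha> n * real n \<longrightarrow>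
           pmf (\<pi> n) \<kappa> \<ge> (real \<kappa> / real n) powr (c2 * real \<kappa>)) \<and>
        (\<forall>\<^sub>F n in sequentially.
           (2 * ln (real n)) powr (p / 2) / real n \<le> \<eta> n powr p \<and> \<eta> n powr p \<le> \<alpha> n)
        \<longrightarrow> ennreal_in_class (R (ennreal p))
              (O(\<lambda>n. (\<sigma> n)\<^sup>2 * real n * \<eta> n powr p *
                       (2 * ln (\<eta> n powr (- p))) powr (1 - p / 2))))
   \<and> (\<forall>(p::real) (\<beta>::real) (c1::real).
        0 < p \<and> p < 2 \<and> \<beta> \<ge> 0 \<and> c1 > 0 \<and>
        (\<forall>\<^sub>F n in sequentially. pmf (\<pi> n) 0 \<ge> real n powr (- c1 * real n powr (- \<beta>))) \<and>
        (\<forall>\<^sub>F n in sequentially. \<eta> n powr p < (2 * ln (real n)) powr (p / 2) / real n)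
        \<longrightarrow> ennreal_in_class (R (ennreal p))
              (bigo_sum (\<lambda>n. (\<sigma> n)\<^sup>2 * real n powr (2 / p) * (\<eta> n)\<^sup>2)
                        (\<lambda>n. (\<sigma> n)\<^sup>2 * real n powr (- \<beta>) * ln (real n))))"
proof -
  have \<gamma>01: "\<gamma>_lo \<le> \<gamma>_hi" using assms(12)[of 1] by simp
  obtain b c K :: real where b: "0 < b" "b \<le> 1 / 2" and c: "0 < c" and K: "0 < K"
    and excess: "\<And>(M :: 'a measure) n z g k p. gaussian_noise M n z \<Longrightarrow> \<gamma>_lo \<le> g \<Longrightarrow> g \<le> \<gamma>_hi \<Longrightarrow>
      1 \<le> k \<Longrightarrow> k \<le> n \<Longrightarrow> 0 < p \<Longrightarrow> p \<le> 1 \<Longrightarrow>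
      gaussian_noise.excess_le M n z b g k p (p + K * (real n + 1) * exp (- c * real n))"
    using excess_constants[OF assms(10) \<gamma>01, where 'a = 'a] by metis
  define v where "v n = K * (real n + 1) * exp (- c * real n)" for n
  define a where "a = 2 * (1 + 1 / \<gamma>_lo)"
  define l where "l = ln (1 + \<gamma>_hi)"
  define A where "A = 1 / b * (2 + 1 / b + a)"
  have a: "2 \<le> a" using assms(10) by (simp add: a_def)
  have l: "0 \<le> l" using assms(11) by (simp add: l_def)
  have v: "0 \<le> v n" for n using K by (simp add: v_def)
  have A: "0 \<le> A" using b a by (simp add: A_def)
  \<comment> \<open>The oracle bound with its constants moved into \<open>A\<close>. Each of the
    four claims then only has to find a set \<open>S\<close> with small
    \<open>H n S \<mu>\<close>.\<close>
  define H where "H n S \<mu> = (\<sigma> n)\<^sup>2 * real (card S) + map_penalty n (\<sigma> n) (\<gamma> n) (\<pi> n) (card S)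
      + (\<Sum>i\<in>{1..n} - S. (\<mu> i)\<^sup>2) + (\<sigma> n)\<^sup>2 * (1 - pmf (\<pi> n) 0 + real n * v n)" for n S and \<mu> :: "nat \<Rightarrow> real"
  have risk_le: "risk (M n) (z n) n (\<sigma> n) (kh n) \<mu> \<le> ennreal (A * H n S \<mu>)"
    if n: "1 \<le> n" and S: "S \<subseteq> {1..n}" for n S \<mu>
  proof -
    interpret prob_space "M n" by (rule assms(1)[OF n])
    interpret gaussian_noise "M n" n "z n"
      by unfold_locales (use assms(2,3) n in auto)
    have \<gamma>n: "\<gamma>_lo \<le> \<gamma> n" "\<gamma> n \<le> \<gamma>_hi" "0 < \<gamma> n" using assms(12)[OF n] assms(10) by auto
    have ex: "excess_le b (\<gamma> n) k (pmf (\<pi> n) k) (pmf (\<pi> n) k + v n)" if "1 \<le> k" "k \<le> n" for k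
    proof -
      have "k \<in> set_pmf (\<pi> n)" unfolding assms(8)[OF n] using that by simp
      then show ?thesis unfolding v_def
        by (rule excess[OF gaussian_noise_axioms \<gamma>n(1,2) that pmf_positive pmf_le_1])
    qed
    define N where "N = 1 - pmf (\<pi> n) 0 + real n * v n"
    define Q where "Q = (\<Sum>i\<in>{1..n} - S. (\<mu> i)\<^sup>2)"
    define P where "P = (\<sigma> n)\<^sup>2 * real (card S) + map_penalty n (\<sigma> n) (\<gamma> n) (\<pi> n) (card S)"
    have cS: "card S \<le> n" using card_mono[OF _ S] by simp
    then have nonneg: "0 \<le> P" "0 \<le> Q" "0 \<le> N"
      using map_penalty_nonneg[of "\<gamma> n" "card S" n "\<pi> n" "\<sigma> n"] \<gamma>n assms(8)[OF n] v
      by (auto simp: P_def Q_def N_def pmf_le_1 sum_nonneg)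
    have "1 + 1 / \<gamma> n \<le> 1 + 1 / \<gamma>_lo"
      using \<gamma>n assms(10) by (intro add_left_mono divide_left_mono) auto
    then have "2 * (1 + 1 / \<gamma> n) \<le> a" by (simp add: a_def)
    then have "(2 * (1 + 1 / \<gamma> n)) * ((\<sigma> n)\<^sup>2 * N) \<le> a * ((\<sigma> n)\<^sup>2 * N)"
      using nonneg by (intro mult_right_mono) auto
    then have "2 * (\<sigma> n)\<^sup>2 * (1 + 1 / \<gamma> n) * N \<le> a * ((\<sigma> n)\<^sup>2 * N)"
      by (simp only: mult_ac)
    then have "P + (2 + 1 / b) * Q + 2 * (\<sigma> n)\<^sup>2 * (1 + 1 / \<gamma> n) * N
        \<le> P + (2 + 1 / b) * Q + a * ((\<sigma> n)\<^sup>2 * N)" by simp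
    also have "\<dots> \<le> (2 + 1 / b + a) * P + (2 + 1 / b + a) * Q + (2 + 1 / b + a) * ((\<sigma> n)\<^sup>2 * N)"
    proof -
      have u: "1 \<le> 2 + 1 / b + a" "2 + 1 / b \<le> 2 + 1 / b + a" "a \<le> 2 + 1 / b + a"
        using a b by (simp_all add: add_increasing)
      have "0 \<le> (\<sigma> n)\<^sup>2 * N" using nonneg by simp
      from add_mono[OF add_mono[OF mult_right_mono[OF u(1) nonneg(1)] mult_right_mono[OF u(2) nonneg(2)]]
          mult_right_mono[OF u(3) this]]
      show ?thesis by simp
    qed
    also have "\<dots> = (2 + 1 / b + a) * H n S \<mu>"
      by (simp add: H_def P_def Q_def N_def algebra_simps)
    finally have "1 / b * (P + (2 + 1 / b) * Q + 2 * (\<sigma> n)\<^sup>2 * (1 + 1 / \<gamma> n) * N) \<le> A * H n S \<mu>"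
      unfolding A_def mult.assoc using b by (intro mult_left_mono) auto
    moreover have "risk (M n) (z n) n (\<sigma> n) (kh n) \<mu>
        \<le> ennreal (1 / b * (P + (2 + 1 / b) * Q + 2 * (\<sigma> n)\<^sup>2 * (1 + 1 / \<gamma> n) * N))"
      using risk_oracle_bound[OF assms(4)[OF n] \<gamma>n(3) assms(8)[OF n] assms(9)[OF n] b v ex S, of \<mu>]
      by (simp add: P_def Q_def N_def)
    ultimately show ?thesis by (meson ennreal_leI order_trans)
  qed
  have max_risk: "R p n \<le> ennreal (A * h)"
    if n: "1 \<le> n" and ball: "\<And>\<mu>. \<mu> \<in> lp_ball n p (\<sigma> n) (\<eta> n) \<Longrightarrow> \<exists>S\<subseteq>{1..n}. H n S \<mu> \<le> h" for p n h
    unfolding R_def max_risk_def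
  proof (rule SUP_least)
    fix \<mu> assume "\<mu> \<in> lp_ball n p (\<sigma> n) (\<eta> n)"
    from ball[OF this] obtain S where S: "S \<subseteq> {1..n}" "H n S \<mu> \<le> h" by blast
    have "ennreal (A * H n S \<mu>) \<le> ennreal (A * h)"
      using S(2) A by (intro ennreal_leI mult_left_mono)
    with risk_le[OF n S(1), of \<mu>] show "risk (M n) (z n) n (\<sigma> n) (kh n) \<mu> \<le> ennreal (A * h)"
      by (rule order_trans)
  qed
  have penalty: "map_penalty n (\<sigma> n) (\<gamma> n) (\<pi> n) k
      \<le> a * (\<sigma> n)\<^sup>2 * (ln (real (n choose k)) - ln (pmf (\<pi> n) k) + real k * l)" if "1 \<le> n" "k \<le> n" for n k
  proof -
    have "2 * (\<sigma> n)\<^sup>2 * (1 + 1 / \<gamma>_lo) = a * (\<sigma> n)\<^sup>2" by (simp add: a_def)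
    moreover have "k \<in> set_pmf (\<pi> n)" unfolding assms(8)[OF that(1)] using that by simp
    ultimately show ?thesis
      using map_penalty_le[OF assms(10), of "\<gamma> n" \<gamma>_hi k n "\<pi> n" "\<sigma> n"] assms(12)[OF that(1)] that
      unfolding l_def by metis
  qed
  have pmf_pos: "0 < pmf (\<pi> n) k" if "1 \<le> n" "k \<le> n" for n k
    using assms(8)[OF that(1)] that(2) by (intro pmf_positive) simp
  \<comment> \<open>Exponential decay beats every power of \<open>n\<close>, so the remainder fits
    into the second rate whatever \<open>\<beta>\<close> is.\<close>
  have small: "\<forall>\<^sub>F n in sequentially. real n * v n \<le> real n powr (- \<beta>) * ln (real n)" for \<beta>
    unfolding v_def using c K by real_asymp
  have ev1: "\<forall>\<^sub>F n in sequentially. 1 \<le> (n::nat)" by (rule eventually_ge_at_top)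
  have small1: "\<forall>\<^sub>F n in sequentially. real n * v n \<le> 1"
    unfolding v_def using c K by real_asymp

  have dense: "ennreal_in_class (R p) (O(\<lambda>n. real n * (\<sigma> n)\<^sup>2))"
    if "0 < c0" and prior: "\<forall>\<^sub>F n in sequentially. pmf (\<pi> n) n \<ge> exp (- c0 * real n)" for p c0
  proof (rule ennreal_in_class_bigoI)
    show "\<forall>\<^sub>F n in sequentially. R p n \<le> ennreal (A * (1 + a * (c0 + l) + 2) * (real n * (\<sigma> n)\<^sup>2))"
      using prior ev1 small1
    proof eventually_elim
      case (elim n)
      have "ln (exp (- c0 * real n)) \<le> ln (pmf (\<pi> n) n)" using elim by (intro ln_mono) auto
      then have "map_penalty n (\<sigma> n) (\<gamma> n) (\<pi> n) n \<le> a * (\<sigma> n)\<^sup>2 * (c0 * real n + real n * l)"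
        using a by (intro order_trans[OF penalty[OF elim(2) order_refl]] mult_left_mono) auto
      moreover have "(\<sigma> n)\<^sup>2 * (1 - pmf (\<pi> n) 0 + real n * v n) \<le> (\<sigma> n)\<^sup>2 * (2 * real n)"
        \<comment> \<open>The bracket is at most 2, hence at most \<open>2 n\<close>.\<close>
        using elim pmf_pos[OF elim(2), of 0] by (intro mult_left_mono) auto
      ultimately have "H n {1..n} \<mu> \<le> (1 + a * (c0 + l) + 2) * (real n * (\<sigma> n)\<^sup>2)" for \<mu>
        by (simp add: H_def algebra_simps)
      then show ?case unfolding mult.assoc by (intro max_risk[OF elim(2)]) blast
    qed
    show "\<forall>\<^sub>F n in sequentially. 0 \<le> A * (1 + a * (c0 + l) + 2) * (real n * (\<sigma> n)\<^sup>2)"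
      using A a l that by (intro always_eventually) simp
  qed

  have null: "ennreal_in_class (R p) (bigo_sum f (\<lambda>n. (\<sigma> n)\<^sup>2 * real n powr (- \<beta>) * ln (real n)))"
    if c1: "0 < c1"
      and prior: "\<forall>\<^sub>F n in sequentially. pmf (\<pi> n) 0 \<ge> real n powr (- c1 * real n powr (- \<beta>))"
      and ball: "\<forall>\<^sub>F n in sequentially. \<forall>\<mu>\<in>lp_ball n p (\<sigma> n) (\<eta> n). (\<Sum>i=1..n. (\<mu> i)\<^sup>2) \<le> D * f n"
      and D: "0 \<le> D" "\<And>n. 0 \<le> f n"
    for p f D c1 \<beta>
  proof (rule ennreal_in_class_bigo_sumI)
    show "\<forall>\<^sub>F n in sequentially. R p n \<le> ennreal (A * D * f n
        + A * (a * c1 + c1 + 1) * ((\<sigma> n)\<^sup>2 * real n powr (- \<beta>) * ln (real n)))"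
      using prior ball ev1 small[of \<beta>]
    proof eventually_elim
      case (elim n)
      define r where "r = real n powr (- \<beta>) * ln (real n)"
      have "ln (real n powr (- c1 * real n powr (- \<beta>))) \<le> ln (pmf (\<pi> n) 0)"
        using elim by (intro ln_mono) auto
      then have p0: "- ln (pmf (\<pi> n) 0) \<le> c1 * r"
        using elim by (simp add: ln_powr r_def mult_ac)
      have "map_penalty n (\<sigma> n) (\<gamma> n) (\<pi> n) 0 \<le> a * (\<sigma> n)\<^sup>2 * (c1 * r)"
        using a p0 by (intro order_trans[OF penalty[OF elim(3)]] mult_left_mono) auto
      \<comment> \<open>From \<open>1 - x \<le> - ln x\<close> the prior mass off 0 is of the order
        of the penalty at size 0.\<close>
      moreover have "1 - pmf (\<pi> n) 0 \<le> c1 * r"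
        using ln_le_minus_one[OF pmf_pos[OF elim(3), of 0]] p0 by simp
      then have "(\<sigma> n)\<^sup>2 * (1 - pmf (\<pi> n) 0 + real n * v n) \<le> (\<sigma> n)\<^sup>2 * (c1 * r + r)"
        using elim(4) by (intro mult_left_mono) (auto simp: r_def)
      ultimately have "H n {} \<mu> \<le> D * f n + (a * c1 + c1 + 1) * ((\<sigma> n)\<^sup>2 * r)"
        if "\<mu> \<in> lp_ball n p (\<sigma> n) (\<eta> n)" for \<mu>
        using elim(2) that by (fastforce simp: H_def algebra_simps)
      then have "R p n \<le> ennreal (A * (D * f n + (a * c1 + c1 + 1) * ((\<sigma> n)\<^sup>2 * r)))"
        by (intro max_risk[OF elim(3)]) blast
      then show ?case by (simp add: r_def algebra_simps)
    qed
    show "\<forall>\<^sub>F n in sequentially. 0 \<le> A * D * f n" using A D by (intro always_eventually) simp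
    show "\<forall>\<^sub>F n in sequentially. 0 \<le> A * (a * c1 + c1 + 1) * ((\<sigma> n)\<^sup>2 * real n powr (- \<beta>) * ln (real n))"
      using ev1 by eventually_elim (use A a c1 in simp)
  qed

  have sparse: "ennreal_in_class (R (ennreal p)) (O(\<lambda>n. (\<sigma> n)\<^sup>2 * real n * \<eta> n powr p *
      (2 * ln (\<eta> n powr (- p))) powr (1 - p / 2)))"
    if p: "0 < p" "p < 2" and c2: "0 < c2"
      and \<alpha>: "\<forall>\<^sub>F n in sequentially. (2 * ln (real n)) powr (p / 2) / real n \<le> \<alpha> n \<and>
           \<alpha> n \<le> exp (- (8 * (\<gamma> n + 3 / 4)\<^sup>2))"
      and prior: "\<forall>\<^sub>F n in sequentially. \<forall>\<kappa>::nat. 1 \<le> \<kappa> \<and> real \<kappa> \<le> \<alpha> n * real n \<longrightarrow>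
           pmf (\<pi> n) \<kappa> \<ge> (real \<kappa> / real n) powr (c2 * real \<kappa>)"
      and \<eta>: "\<forall>\<^sub>F n in sequentially. (2 * ln (real n)) powr (p / 2) / real n \<le> \<eta> n powr p \<and> \<eta> n powr p \<le> \<alpha> n"
    for p \<alpha> c2
  proof (rule ennreal_in_class_bigoI)
    \<comment> \<open>In order, the summands account for the size of \<open>S\<close>, its penalty,
      the signal outside \<open>S\<close> and the remainder.\<close>
    define C where "C = 1 + a * (4 + 3 * c2 + l) + 1 + 2"
    define L where "L n = 2 * ln (\<eta> n powr (- p))" for n
    have ev3: "\<forall>\<^sub>F n in sequentially. 3 \<le> (n::nat)" by (rule eventually_ge_at_top)
    show "\<forall>\<^sub>F n in sequentially. R (ennreal p) n \<le> ennreal (A * C * ((\<sigma> n)\<^sup>2 * real n * \<eta> n powr p *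
      (2 * ln (\<eta> n powr (- p))) powr (1 - p / 2)))"
      using \<alpha> prior \<eta> ev3 small1 unfolding L_def[symmetric]
    proof eventually_elim
      case (elim n)
      then have n: "1 \<le> n" "0 < real n" by auto
      have pos: "0 < \<sigma> n" "0 < \<eta> n" "0 < \<gamma> n" using assms(4,6,12)[OF n(1)] assms(10) by auto
      \<comment> \<open>The size that balances the two errors: a penalty of order \<open>L\<close>
        per coordinate gives \<open>x L = r\<close>, and \<open>r\<close> is also the signal left
        below the threshold, in units of \<open>\<sigma>^2\<close>.\<close>
      define x where "x = real n * \<eta> n powr p / L n powr (p / 2)"
      define k where "k = nat \<lfloor>x\<rfloor>"
      define r where "r = real n * \<eta> n powr p * L n powr (1 - p / 2)"
      have Ln: "L n = - 2 * ln (\<eta> n powr p)" using pos by (simp add: L_def ln_powr)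
      \<comment> \<open>The upper bound on \<open>\<alpha>\<close> enters here:
        \<open>\<eta>^p\<close> stays far enough below 1 for \<open>L \<ge> 1\<close>.\<close>
      have "8 * (3 / 4)\<^sup>2 \<le> 8 * (\<gamma> n + 3 / 4)\<^sup>2" using pos by (intro mult_left_mono power_mono) auto
      then have "exp (- (8 * (\<gamma> n + 3 / 4)\<^sup>2)) \<le> exp (- (1 / 2))" by (simp add: power2_eq_square)
      then have e1: "\<eta> n powr p \<le> exp (- (1 / 2))" using elim by linarith
      then have "ln (\<eta> n powr p) \<le> ln (exp (- (1 / 2)))" using pos by (intro ln_mono) auto
      then have L1: "1 \<le> L n" unfolding Ln by simp
      have "exp 1 \<le> real n" using exp_le elim(4) by linarith
      then have "ln (exp 1) \<le> ln (real n)" by (intro ln_mono) auto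
      then have ln1: "1 \<le> ln (real n)" by simp
      \<comment> \<open>The lower bound on the radius is used twice: it first gives
        \<open>\<eta>^p \<ge> 1 / n\<close> and so \<open>L \<le> 2 ln n\<close>, and then
        \<open>x \<ge> 1\<close>, so that the integer part of \<open>x\<close> is a positive
        size.\<close>
      then have "1 \<le> (2 * ln (real n)) powr (p / 2)" using p by (intro ge_one_powr_ge_zero) auto
      then have "1 / real n \<le> (2 * ln (real n)) powr (p / 2) / real n" using n by (intro divide_right_mono) auto
      then have "1 / real n \<le> \<eta> n powr p" using elim by linarith
      then have "ln (1 / real n) \<le> ln (\<eta> n powr p)" using n by (intro ln_mono) auto
      then have "L n \<le> 2 * ln (real n)" unfolding Ln using n by (simp add: ln_div)
      then have "L n powr (p / 2) \<le> (2 * ln (real n)) powr (p / 2)" using L1 p by (intro powr_mono2) auto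
      also have "\<dots> \<le> real n * \<eta> n powr p" using elim n by (simp add: field_simps)
      finally have x1: "1 \<le> x" using L1 by (simp add: x_def)
      have "1 \<le> L n powr (p / 2)" using L1 p by (intro ge_one_powr_ge_zero) auto
      then have xle: "x \<le> real n * \<eta> n powr p"
        unfolding x_def using divide_left_mono[of 1 "L n powr (p / 2)" "real n * \<eta> n powr p"] L1 by simp
      have kx: "1 \<le> k" "real k \<le> x" "x < real k + 1" using x1 by (auto simp: k_def le_nat_iff le_floor_iff)
      have "real n * \<eta> n powr p \<le> real n * 1"
        using e1 n by (intro mult_left_mono) (auto intro: order_trans)
      then have kn: "k \<le> n" using kx xle by linarith
      have xL: "x * L n = r"
        unfolding x_def r_def using L1 by (simp add: powr_diff)
      have "real n * \<eta> n powr p \<le> real n * \<alpha> n" using elim n by (intro mult_left_mono) auto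
      then have "real k \<le> \<alpha> n * real n" using kx xle by (simp add: mult.commute)
      then have pk: "(real k / real n) powr (c2 * real k) \<le> pmf (\<pi> n) k" using elim kx by blast
      \<comment> \<open>As \<open>x \<ge> 1\<close>, taking the integer part loses at most a factor
        2, so \<open>n / k \<le> 2 L^(p/2) / \<eta>^p\<close>. Its logarithm is of order
        \<open>L\<close>, since \<open>- ln (\<eta>^p) = L / 2\<close>. This makes the binomial
        coefficient and the prior weight cost order \<open>k L\<close> each.\<close>
      have ratio: "ln (real n / real k) \<le> 3 * L n"
      proof -
        have "real n / real k \<le> 2 * (real n / x)"
        proof -
          have k1: "1 \<le> real k" using kx by simp
          then have "x * real n \<le> 2 * real k * real n" using kx by (intro mult_right_mono) linarith+
          then show ?thesis using k1 x1 by (simp add: divide_le_eq le_divide_eq mult_ac)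
        qed
        also have "real n / x = L n powr (p / 2) / \<eta> n powr p"
          using n by (simp add: x_def)
        finally have "ln (real n / real k) \<le> ln (2 * (L n powr (p / 2) / \<eta> n powr p))"
          using n kx by (intro ln_mono) auto
        also have "\<dots> = ln 2 + p / 2 * ln (L n) + L n / 2"
        proof -
          define E where "E = \<eta> n powr p"
          define P where "P = L n powr (p / 2)"
          have "0 < E" "0 < P" using pos L1 by (auto simp: E_def P_def)
          then have "ln (2 * (P / E)) = ln 2 + (ln P - ln E)" by (simp add: ln_mult ln_div)
          moreover have "ln P = p / 2 * ln (L n)" using L1 by (simp add: P_def ln_powr)
          moreover have "ln E = - (L n / 2)" unfolding Ln by (simp add: E_def)
          ultimately show ?thesis by (simp add: E_def P_def)
        qed
        also have "\<dots> \<le> 1 + 1 * L n + L n / 2"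
        proof (intro add_mono mult_mono)
          show "ln (L n) \<le> L n" using ln_le_minus_one[of "L n"] L1 by simp
          show "ln 2 \<le> (1::real)" using ln_le_minus_one[of "2::real"] by simp
        qed (use p L1 in auto)
        finally show ?thesis using L1 by linarith
      qed
      have "ln ((real k / real n) powr (c2 * real k)) \<le> ln (pmf (\<pi> n) k)"
        using pk kx n by (intro ln_mono) auto
      then have "- ln (pmf (\<pi> n) k) \<le> c2 * real k * ln (real n / real k)"
        using kx n by (simp add: ln_powr ln_div algebra_simps)
      also have "\<dots> \<le> c2 * real k * (3 * L n)" using ratio c2 by (intro mult_left_mono) auto
      finally have lp: "- ln (pmf (\<pi> n) k) \<le> 3 * c2 * (real k * L n)" by (simp add: mult_ac)
      have kL: "real k * L n \<le> r" unfolding xL[symmetric] using kx L1 by (intro mult_right_mono) auto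
      have k_le: "real k \<le> real k * L n" using L1 by (simp add: mult_le_cancel_left1)
      have "real k * (1 + ln (real n / real k)) \<le> real k * (1 + 3 * L n)"
        using ratio by (intro mult_left_mono) auto
      with ln_binomial_le[OF kx(1) kn] have "ln (real (n choose k)) \<le> real k * (1 + 3 * L n)"
        by (rule order_trans)
      then have lb: "ln (real (n choose k)) \<le> 4 * (real k * L n)" using k_le by (simp add: algebra_simps)
      have "real k * l \<le> (real k * L n) * l" using k_le l by (intro mult_right_mono)
      with lp lb have "ln (real (n choose k)) - ln (pmf (\<pi> n) k) + real k * l \<le> (4 + 3 * c2 + l) * (real k * L n)"
        by (simp add: algebra_simps)
      also have "\<dots> \<le> (4 + 3 * c2 + l) * r" using kL l c2 by (intro mult_left_mono) auto
      finally have "map_penalty n (\<sigma> n) (\<gamma> n) (\<pi> n) k \<le> a * (\<sigma> n)\<^sup>2 * ((4 + 3 * c2 + l) * r)"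
        using a by (intro order_trans[OF penalty[OF n(1) kn]] mult_left_mono) auto
      then have pen: "map_penalty n (\<sigma> n) (\<gamma> n) (\<pi> n) k \<le> a * (4 + 3 * c2 + l) * ((\<sigma> n)\<^sup>2 * r)"
        by (simp add: mult_ac)
      have r1: "real k \<le> r" "1 \<le> r" using k_le kL kx by linarith+
      have s1: "(\<sigma> n)\<^sup>2 * real k \<le> 1 * ((\<sigma> n)\<^sup>2 * r)" using r1 by (simp add: mult_left_mono)
      have s2: "(\<sigma> n)\<^sup>2 * (1 - pmf (\<pi> n) 0 + real n * v n) \<le> (\<sigma> n)\<^sup>2 * (2 * r)"
        using elim(5) r1 pmf_pos[OF n(1), of 0] by (intro mult_left_mono) auto
      have "\<exists>S\<subseteq>{1..n}. H n S \<mu> \<le> C * ((\<sigma> n)\<^sup>2 * r)" if \<mu>: "\<mu> \<in> lp_ball n (ennreal p) (\<sigma> n) (\<eta> n)" for \<mu>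
      proof -
        have "real n * \<eta> n powr p / L n powr (p / 2) < real k + 1" using kx by (simp add: x_def)
        then obtain S where S: "S \<subseteq> {1..n}" "card S = k"
          "(\<Sum>i\<in>{1..n} - S. (\<mu> i)\<^sup>2) \<le> (\<sigma> n)\<^sup>2 * real n * \<eta> n powr p * L n powr (1 - p / 2)"
          using lp_ball_sparse_approximation[OF p pos(1,2) n(1) _ \<mu> _ kn] L1 by (metis less_le_trans zero_less_one)
        have "(\<Sum>i\<in>{1..n} - S. (\<mu> i)\<^sup>2) \<le> 1 * ((\<sigma> n)\<^sup>2 * r)" using S(3) by (simp add: r_def mult_ac)
        then have "H n S \<mu> \<le> 1 * ((\<sigma> n)\<^sup>2 * r) + a * (4 + 3 * c2 + l) * ((\<sigma> n)\<^sup>2 * r)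
            + 1 * ((\<sigma> n)\<^sup>2 * r) + (\<sigma> n)\<^sup>2 * (2 * r)"
          unfolding H_def S(2) by (intro add_mono s1 s2 pen)
        also have "\<dots> = C * ((\<sigma> n)\<^sup>2 * r)" by (simp add: C_def algebra_simps)
        finally show ?thesis using S(1) by blast
      qed
      then have "R (ennreal p) n \<le> ennreal (A * (C * ((\<sigma> n)\<^sup>2 * r)))" by (rule max_risk[OF n(1)])
      then show ?case by (simp add: r_def mult_ac)
    qed
    show "\<forall>\<^sub>F n in sequentially. 0 \<le> A * C * ((\<sigma> n)\<^sup>2 * real n * \<eta> n powr p *
      (2 * ln (\<eta> n powr (- p))) powr (1 - p / 2))"
      using A a l c2 by (intro always_eventually) (simp add: C_def)
  qed

  have ball2: "\<forall>\<^sub>F n in sequentially. \<forall>\<mu>\<in>lp_ball n p (\<sigma> n) (\<eta> n).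
      (\<Sum>i=1..n. (\<mu> i)\<^sup>2) \<le> 2 * ((\<sigma> n)\<^sup>2 * real n * (\<eta> n)\<^sup>2)" if "2 \<le> p" for p
    using ev1 by eventually_elim (use lp_ball_sum_squares_le_of_ge_2 that assms(4,6) in blast)
  have ball4: "\<forall>\<^sub>F n in sequentially. \<forall>\<mu>\<in>lp_ball n (ennreal p) (\<sigma> n) (\<eta> n).
      (\<Sum>i=1..n. (\<mu> i)\<^sup>2) \<le> 1 * ((\<sigma> n)\<^sup>2 * real n powr (2 / p) * (\<eta> n)\<^sup>2)" if "0 < p" "p < 2" for p
    unfolding mult_1
    using ev1 by eventually_elim (use lp_ball_sum_squares_le_of_less_2 that assms(4,6) in blast)
  show ?thesis
  proof (intro conjI allI impI; elim conjE)
    fix p :: ennreal and c0 :: real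
    assume "c0 > 0" "\<forall>\<^sub>F n in sequentially. pmf (\<pi> n) n \<ge> exp (- c0 * real n)"
    then show "ennreal_in_class (R p) (O(\<lambda>n. real n * (\<sigma> n)\<^sup>2))" by (rule dense)
  next
    fix p :: ennreal and \<beta> c1 :: real
    assume "2 \<le> p" and h: "c1 > 0"
      "\<forall>\<^sub>F n in sequentially. pmf (\<pi> n) 0 \<ge> real n powr (- c1 * real n powr (- \<beta>))"
    then show "ennreal_in_class (R p) (bigo_sum (\<lambda>n. (\<sigma> n)\<^sup>2 * real n * (\<eta> n)\<^sup>2)
        (\<lambda>n. (\<sigma> n)\<^sup>2 * real n powr (- \<beta>) * ln (real n)))"
      by (intro null[OF h ball2]) auto
  next
    fix p c2 :: real and \<alpha> :: "nat \<Rightarrow> real"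
    assume "0 < p" "p < 2" "c2 > 0"
      "\<forall>\<^sub>F n in sequentially. (2 * ln (real n)) powr (p / 2) / real n \<le> \<alpha> n \<and>
           \<alpha> n \<le> exp (- (8 * (\<gamma> n + 3 / 4)\<^sup>2))"
      "\<forall>\<^sub>F n in sequentially. \<forall>\<kappa>::nat. 1 \<le> \<kappa> \<and> real \<kappa> \<le> \<alpha> n * real n \<longrightarrow>
           pmf (\<pi> n) \<kappa> \<ge> (real \<kappa> / real n) powr (c2 * real \<kappa>)"
      "\<forall>\<^sub>F n in sequentially. (2 * ln (real n)) powr (p / 2) / real n \<le> \<eta> n powr p \<and> \<eta> n powr p \<le> \<alpha> n"
    then show "ennreal_in_class (R (ennreal p)) (O(\<lambda>n. (\<sigma> n)\<^sup>2 * real n * \<eta> n powr p *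
      (2 * ln (\<eta> n powr (- p))) powr (1 - p / 2)))"
      by (rule sparse)
  next
    fix p \<beta> c1 :: real
    assume "0 < p" "p < 2" and h: "c1 > 0"
      "\<forall>\<^sub>F n in sequentially. pmf (\<pi> n) 0 \<ge> real n powr (- c1 * real n powr (- \<beta>))"
    then show "ennreal_in_class (R (ennreal p)) (bigo_sum (\<lambda>n. (\<sigma> n)\<^sup>2 * real n powr (2 / p) * (\<eta> n)\<^sup>2)
        (\<lambda>n. (\<sigma> n)\<^sup>2 * real n powr (- \<beta>) * ln (real n)))"
      by (intro null[OF h ball4]) auto
  qed
qed

end
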